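(* Let $G=\mathrm{Isom}(\mathbf{H})$ with its Polish topology. The universal minimal flow $M(G)$ is not metrizable.
   Context: Let $\mathcal{H}$ be an infinite-dimensional separable real Hilbert space with Hilbert basis $(e_i)_{i\in\mathbb{N}}$ and $Q(x)=x_0^2-\sum_{i\ge1}x_i^2$, with polarized symmetric bilinear form $(\cdot,\cdot)$. The hyperbolic space is $\mathbf{H}=\{x\in\mathcal{H}: Q(x)=1,\ x_0>0\}$ with $\cosh d(x,y)=(x,y)$. $\mathrm{Isom}(\mathbf{H})$ is its isometry group with the topology of pointwise convergence, which is Polish. A $G$-flow is a continuous action of a topological group $G$ on a non-empty compact Hausdorff space; it is minimal if every orbit is dense. The universal minimal flow $M(G)$ is the (unique up to isomorphism) minimal $G$-flow such that for every $G$-flow $X$ there is a continuous $G$-equivariant map $M(G)\to X$. *)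

theory Defs
  imports "HOL-Analysis.Analysis" "HOL-Algebra.Group_Action"
begin

section \<open>Flows and universal minimal flows\<close>

text \<open>
  A topological group is given by a group \<open>G\<close> together with a topology \<open>T\<close> on its carrier.
  The action is jointly continuous.
\<close>

definition flow ::
  "('g, 'b) monoid_scheme \<Rightarrow> 'g topology \<Rightarrow> 'x topology \<Rightarrow> ('g \<Rightarrow> 'x \<Rightarrow> 'x) \<Rightarrow> bool"
  where "flow G T X \<phi> \<longleftrightarrow>
    compact_space X \<and> Hausdorff_space X \<and> topspace X \<noteq> {} \<and>
    group_action G (topspace X) \<phi> \<and>
    continuous_map (prod_topology T X) X (\<lambda>(g, x). \<phi> g x)"

definition minimal_flow ::
  "('g, 'b) monoid_scheme \<Rightarrow> 'g topology \<Rightarrow> 'x topology \<Rightarrow> ('g \<Rightarrow> 'x \<Rightarrow> 'x) \<Rightarrow> bool"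
  where "minimal_flow G T X \<phi> \<longleftrightarrow>
    flow G T X \<phi> \<and> (\<forall>x\<in>topspace X. X closure_of orbit G \<phi> x = topspace X)"

definition flow_morphism ::
  "('g, 'b) monoid_scheme \<Rightarrow> 'x topology \<Rightarrow> ('g \<Rightarrow> 'x \<Rightarrow> 'x) \<Rightarrow> 'y topology \<Rightarrow> ('g \<Rightarrow> 'y \<Rightarrow> 'y)
    \<Rightarrow> ('x \<Rightarrow> 'y) \<Rightarrow> bool"
  where "flow_morphism G X \<phi> Y \<psi> f \<longleftrightarrow>
    continuous_map X Y f \<and> (\<forall>g\<in>carrier G. \<forall>x\<in>topspace X. f (\<phi> g x) = \<psi> g (f x))"

text \<open>
  The universal property quantifies over all flows, which in HOL must live on a fixed type.
  The type \<open>'g set set\<close> is large enough: every flow contains a minimal one, which has a dense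
  orbit and hence injects into the double power set of \<open>G\<close>. Consequently the universal property
  holds for flows on arbitrary types (theorem \<open>universal_minimal_flow_morphism\<close> below), and a
  universal minimal flow exists (theorem \<open>universal_minimal_flow_exists\<close> below).
\<close>

definition universal_minimal_flow ::
  "('g, 'b) monoid_scheme \<Rightarrow> 'g topology \<Rightarrow> 'm topology \<Rightarrow> ('g \<Rightarrow> 'm \<Rightarrow> 'm) \<Rightarrow> bool"
  where "universal_minimal_flow G T M \<phi> \<longleftrightarrow>
    minimal_flow G T M \<phi> \<and>
    (\<forall>(X :: 'g set set topology) \<psi>. flow G T X \<psi> \<longrightarrow> (\<exists>f. flow_morphism G M \<phi> X \<psi> f))"

lemma group_actionI:
  assumes "group G"
    and cl: "\<And>g x. g \<in> carrier G \<Longrightarrow> x \<in> E \<Longrightarrow> a g x \<in> E"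
    and one: "\<And>x. x \<in> E \<Longrightarrow> a \<one>\<^bsub>G\<^esub> x = x"
    and mul: "\<And>g h x. g \<in> carrier G \<Longrightarrow> h \<in> carrier G \<Longrightarrow> x \<in> E \<Longrightarrow> a (g \<otimes>\<^bsub>G\<^esub> h) x = a g (a h x)"
  shows "group_action G E (\<lambda>g. restrict (a g) E)"
proof -
  interpret group G by fact
  have bij: "restrict (a g) E \<in> Bij E" if g: "g \<in> carrier G" for g
  proof -
    have "bij_betw (a g) E E"
    proof (rule bij_betw_byWitness[where f' = "a (inv\<^bsub>G\<^esub> g)"])
      show "\<forall>x\<in>E. a (inv\<^bsub>G\<^esub> g) (a g x) = x"
        using g mul[of "inv\<^bsub>G\<^esub> g" g] one by simp
      show "\<forall>x\<in>E. a g (a (inv\<^bsub>G\<^esub> g) x) = x"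
        using g mul[of g "inv\<^bsub>G\<^esub> g"] one by simp
    qed (use g cl in auto)
    then show ?thesis by (simp add: Bij_def)
  qed
  have "(\<lambda>g. restrict (a g) E) \<in> hom G (BijGroup E)"
  proof (rule homI)
    fix g assume "g \<in> carrier G"
    then show "restrict (a g) E \<in> carrier (BijGroup E)" using bij by (simp add: BijGroup_def)
  next
    fix g h assume gh: "g \<in> carrier G" "h \<in> carrier G"
    then have "restrict (a (g \<otimes>\<^bsub>G\<^esub> h)) E = compose E (restrict (a g) E) (restrict (a h) E)"
      by (auto simp: fun_eq_iff compose_def mul cl)
    then show "restrict (a (g \<otimes>\<^bsub>G\<^esub> h)) E = restrict (a g) E \<otimes>\<^bsub>BijGroup E\<^esub> restrict (a h) E"
      using gh bij by (simp add: BijGroup_def)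
  qed
  then show ?thesis
    by (intro group_action.intro group_hom.intro group_BijGroup group_hom_axioms.intro \<open>group G\<close>)
qed

lemma flowI:
  assumes "group G" "topspace T = carrier G"
    and "compact_space X" "Hausdorff_space X" "topspace X \<noteq> {}"
    and one: "\<And>x. x \<in> topspace X \<Longrightarrow> a \<one>\<^bsub>G\<^esub> x = x"
    and mul: "\<And>g h x. g \<in> carrier G \<Longrightarrow> h \<in> carrier G \<Longrightarrow> x \<in> topspace X
      \<Longrightarrow> a (g \<otimes>\<^bsub>G\<^esub> h) x = a g (a h x)"
    and cont: "continuous_map (prod_topology T X) X (\<lambda>(g, x). a g x)"
  shows "flow G T X (\<lambda>g. restrict (a g) (topspace X))"
proof -
  have "a g x \<in> topspace X" if "g \<in> carrier G" "x \<in> topspace X" for g x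
    using continuous_map_image_subset_topspace[OF cont] that assms(2) by fastforce
  then have "group_action G (topspace X) (\<lambda>g. restrict (a g) (topspace X))"
    using assms by (intro group_actionI) auto
  moreover have "continuous_map (prod_topology T X) X (\<lambda>(g, x). restrict (a g) (topspace X) x)"
    by (rule continuous_map_eq[OF cont]) auto
  ultimately show ?thesis
    using assms by (simp add: flow_def)
qed

lemma
  assumes "flow G T X \<phi>"
  shows flow_group: "group G"
    and flow_one: "x \<in> topspace X \<Longrightarrow> \<phi> \<one>\<^bsub>G\<^esub> x = x"
    and flow_mult: "g \<in> carrier G \<Longrightarrow> h \<in> carrier G \<Longrightarrow> x \<in> topspace X
      \<Longrightarrow> \<phi> (g \<otimes>\<^bsub>G\<^esub> h) x = \<phi> g (\<phi> h x)"
    and flow_closed: "g \<in> carrier G \<Longrightarrow> x \<in> topspace X \<Longrightarrow> \<phi> g x \<in> topspace X"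
proof -
  interpret group_action G "topspace X" \<phi> using assms by (simp add: flow_def)
  show "group G" using group_hom by (simp add: group_hom_def)
  show "x \<in> topspace X \<Longrightarrow> \<phi> \<one>\<^bsub>G\<^esub> x = x"
    by (metis id_eq_one restrict_apply')
  show "g \<in> carrier G \<Longrightarrow> h \<in> carrier G \<Longrightarrow> x \<in> topspace X
      \<Longrightarrow> \<phi> (g \<otimes>\<^bsub>G\<^esub> h) x = \<phi> g (\<phi> h x)"
    by (rule composition_rule)
  show "g \<in> carrier G \<Longrightarrow> x \<in> topspace X \<Longrightarrow> \<phi> g x \<in> topspace X"
    using element_image by blast
qed

lemma flow_nonempty: "flow G T X \<phi> \<Longrightarrow> topspace X \<noteq> {}"
  unfolding flow_def by blast

lemma flow_continuous:
  assumes "flow G T X \<phi>" "topspace T = carrier G" "g \<in> carrier G"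
  shows "continuous_map X X (\<phi> g)"
proof -
  have "continuous_map X (prod_topology T X) (\<lambda>x. (g, x))"
    using assms by (simp add: continuous_map_paired)
  then have "continuous_map X X ((\<lambda>(g, x). \<phi> g x) \<circ> (\<lambda>x. (g, x)))"
    using assms by (intro continuous_map_compose) (auto simp: flow_def)
  then show ?thesis by (simp add: o_def)
qed

lemma minimal_subflow_exists:
  assumes fl: "flow G T X \<phi>" and T: "topspace T = carrier G"
  shows "\<exists>C. C \<subseteq> topspace X \<and> minimal_flow G T (subtopology X C) (\<lambda>g. restrict (\<phi> g) C)"
proof -
  interpret group G using flow_group[OF fl] .
  define A where "A = {U. openin X U \<and> U \<noteq> topspace X \<and>
    (\<forall>g\<in>carrier G. \<forall>x\<in>topspace X. \<phi> g x \<in> U \<longrightarrow> x \<in> U)}"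
  have "{} \<in> A" using flow_nonempty[OF fl] by (auto simp: A_def simp del: null_topspace_iff_trivial)
  moreover have "\<Union>\<C> \<in> A" if "\<C> \<noteq> {}" and ch: "subset.chain A \<C>" for \<C>
  proof -
    have CA: "\<C> \<subseteq> A" using ch by (simp add: subset_chain_def)
    have "\<Union>\<C> \<noteq> topspace X"
    proof
      assume eq: "\<Union>\<C> = topspace X"
      moreover have "\<forall>V\<in>\<C>. openin X V" using CA by (auto simp: A_def)
      moreover have "compact_space X" using fl by (simp add: flow_def)
      ultimately obtain F where F: "finite F" "F \<subseteq> \<C>" "topspace X \<subseteq> \<Union>F"
        by (metis compact_space_alt order_refl)
      then have "F \<noteq> {}" using flow_nonempty[OF fl] by blast
      moreover have "subset.chain A F"
        using ch F(2) unfolding subset_chain_def by (meson subset_iff)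
      ultimately have "\<Union>F \<in> \<C>"
        using Union_in_chain[of F A] \<open>subset.chain A F\<close> F by blast
      then have "\<Union>F \<in> A" using CA by blast
      then have "\<Union>F \<noteq> topspace X" "openin X (\<Union>F)" by (auto simp: A_def)
      then show False
        using F(3) openin_subset by blast
    qed
    moreover have "openin X (\<Union>\<C>)" using CA by (intro openin_Union) (auto simp: A_def)
    moreover have "\<forall>g\<in>carrier G. \<forall>x\<in>topspace X. \<phi> g x \<in> \<Union>\<C> \<longrightarrow> x \<in> \<Union>\<C>"
      using CA by (fastforce simp: A_def)
    ultimately show ?thesis by (simp add: A_def)
  qed
  ultimately obtain U where U: "U \<in> A" and max: "\<And>V. V \<in> A \<Longrightarrow> U \<subseteq> V \<Longrightarrow> V = U"
    using subset_Zorn_nonempty[of A] by blast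
  define C where "C = topspace X - U"
  have Usub: "U \<subseteq> topspace X" using U openin_subset by (auto simp: A_def)
  have C: "closedin X C" "C \<subseteq> topspace X" "C \<noteq> {}"
    using U Usub by (auto simp: A_def C_def)
  have inv: "\<phi> g x \<in> C" if "g \<in> carrier G" "x \<in> C" for g x
    using that U flow_closed[OF fl] by (auto simp: A_def C_def)
  have top: "topspace (subtopology X C) = C" using C by auto
  have "flow G T (subtopology X C) (\<lambda>g. restrict (\<phi> g) (topspace (subtopology X C)))"
  proof (rule flowI)
    show "compact_space (subtopology X C)"
      using C fl by (simp add: flow_def closedin_compact_space compact_space_subtopology)
    show "Hausdorff_space (subtopology X C)"
      using fl by (simp add: flow_def Hausdorff_space_subtopology)
    have "continuous_map (prod_topology T X) X (\<lambda>(g, x). \<phi> g x)"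
      using fl by (simp add: flow_def)
    then show "continuous_map (prod_topology T (subtopology X C)) (subtopology X C) (\<lambda>(g, x). \<phi> g x)"
      unfolding prod_topology_subtopology
      by (intro continuous_map_into_subtopology continuous_map_from_subtopology)
        (use inv T in auto)
  qed (use T C flow_one[OF fl] flow_mult[OF fl] is_group in auto)
  then have sub: "flow G T (subtopology X C) (\<lambda>g. restrict (\<phi> g) C)"
    by (simp only: top)
  have dense: "subtopology X C closure_of orbit G (\<lambda>g. restrict (\<phi> g) C) x = C" if x: "x \<in> C" for x
  proof -
    let ?O = "orbit G (\<lambda>g. restrict (\<phi> g) C) x"
    let ?D = "X closure_of ?O"
    have O: "?O = {\<phi> g x | g. g \<in> carrier G}" using x by (simp add: orbit_def)
    have OC: "?O \<subseteq> C" using O x inv by auto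
    then have DC: "?D \<subseteq> C" using C by (simp add: closure_of_minimal)
    have xX: "x \<in> topspace X" using x C by blast
    have "x \<in> ?O" unfolding O using flow_one[OF fl xX] by force
    then have xD: "x \<in> ?D" using OC C closure_of_subset[of ?O X] by blast
    have invD: "\<phi> g y \<in> ?D" if g: "g \<in> carrier G" and y: "y \<in> ?D" for g y
    proof -
      have "\<phi> g ` ?O \<subseteq> ?O"
      proof
        fix z assume "z \<in> \<phi> g ` ?O"
        then obtain h where h: "h \<in> carrier G" "z = \<phi> g (\<phi> h x)" using O by auto
        then have "z = \<phi> (g \<otimes>\<^bsub>G\<^esub> h) x" using flow_mult[OF fl g _ xX] by simp
        then show "z \<in> ?O" unfolding O using g h by blast
      qed
      then have "X closure_of (\<phi> g ` ?O) \<subseteq> ?D" by (rule closure_of_mono)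
      moreover have "\<phi> g ` ?D \<subseteq> X closure_of (\<phi> g ` ?O)"
        by (rule continuous_map_image_closure_subset[OF flow_continuous[OF fl T g]])
      ultimately show ?thesis using y by blast
    qed
    have "topspace X - ?D \<in> A"
      unfolding A_def using xD xX invD by auto
    moreover have "U \<subseteq> topspace X - ?D"
      using DC Usub by (auto simp: C_def)
    ultimately have "topspace X - ?D = U" by (rule max)
    then have "?D = C" using closure_of_subset_topspace[of X ?O] by (auto simp: C_def)
    then show ?thesis
      using OC by (simp add: closure_of_subtopology Int_absorb1)
  qed
  have "minimal_flow G T (subtopology X C) (\<lambda>g. restrict (\<phi> g) C)"
    unfolding minimal_flow_def using sub dense top by simp
  then show ?thesis using C by blast
qed

text \<open>
  A point of a Hausdorff space with a dense \<open>G\<close>-orbit is determined by the subsets of \<open>G\<close> whose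
  part of the orbit accumulates there.
\<close>

lemma minimal_flow_transfer:
  fixes G :: "('g, 'b) monoid_scheme" and X :: "'x topology"
  assumes mf: "minimal_flow G T X \<phi>" and T: "topspace T = carrier G"
  shows "\<exists>(Y :: 'g set set topology) \<psi> h k. minimal_flow G T Y \<psi> \<and>
    homeomorphic_maps X Y h k \<and> flow_morphism G X \<phi> Y \<psi> h \<and> flow_morphism G Y \<psi> X \<phi> k"
proof -
  have fl: "flow G T X \<phi>" using mf by (simp add: minimal_flow_def)
  interpret group G using flow_group[OF fl] .
  let ?S = "topspace X"
  obtain p where p: "p \<in> ?S" using flow_nonempty[OF fl] by blast
  have dense: "X closure_of orbit G \<phi> p = ?S" using mf p by (simp add: minimal_flow_def)
  define h where "h = (\<lambda>x. {B. B \<subseteq> carrier G \<and> x \<in> X closure_of ((\<lambda>g. \<phi> g p) ` B)})"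
  have "inj_on h ?S"
  proof (rule inj_onI, rule ccontr)
    fix x y assume xy: "x \<in> ?S" "y \<in> ?S" "h x = h y" "x \<noteq> y"
    then obtain U V where UV: "openin X U" "openin X V" "x \<in> U" "y \<in> V" "disjnt U V"
      using fl unfolding flow_def Hausdorff_space_def by metis
    define B where "B = {g \<in> carrier G. \<phi> g p \<in> U}"
    have im: "(\<lambda>g. \<phi> g p) ` B = U \<inter> orbit G \<phi> p"
      by (auto simp: B_def orbit_def)
    have "x \<in> X closure_of (U \<inter> orbit G \<phi> p)"
      using openin_Int_closure_of_subset[OF UV(1), of "orbit G \<phi> p"] dense xy UV by auto
    then have "B \<in> h x" by (simp add: h_def im) (simp add: B_def)
    then have "y \<in> X closure_of (U \<inter> orbit G \<phi> p)" unfolding xy(3) by (simp add: h_def im)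
    then obtain z where "z \<in> U \<inter> orbit G \<phi> p" "z \<in> V"
      using UV by (meson in_closure_of)
    then show False using UV by (auto simp: disjnt_def)
  qed
  define k where "k = inv_into ?S h"
  have kh: "k (h x) = x" if "x \<in> ?S" for x
    using that \<open>inj_on h ?S\<close> by (simp add: k_def)
  define Y where "Y = pullback_topology (h ` ?S) k X"
  have topY: "topspace Y = h ` ?S"
    using kh by (auto simp: Y_def topspace_pullback_topology)
  have "continuous_map X Y h"
    unfolding Y_def
    by (intro continuous_map_pullback' continuous_map_eq[OF continuous_map_id]) (auto simp: kh)
  moreover have "continuous_map Y X k"
    using continuous_map_pullback[OF continuous_map_id, of "h ` ?S" k X] by (simp add: Y_def)
  ultimately have hk: "homeomorphic_maps X Y h k"
    using kh topY by (auto simp: homeomorphic_maps_def)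
  then have hc: "continuous_map X Y h" and kc: "continuous_map Y X k"
    by (auto simp: homeomorphic_maps_def)
  have XY: "X homeomorphic_space Y" using hk homeomorphic_maps_imp_homeomorphic_space by blast
  define \<psi> where "\<psi> = (\<lambda>g. restrict (\<lambda>y. h (\<phi> g (k y))) (topspace Y))"
  have flY: "flow G T Y \<psi>"
    unfolding \<psi>_def
  proof (rule flowI)
    show "compact_space Y" "Hausdorff_space Y" "topspace Y \<noteq> {}"
      using fl homeomorphic_compact_space[OF XY] homeomorphic_Hausdorff_space[OF XY] p
      by (auto simp: flow_def topY)
    have "continuous_map (prod_topology T Y) (prod_topology T X) (\<lambda>z. (fst z, k (snd z)))"
      unfolding continuous_map_paired
      using continuous_map_compose[OF continuous_map_snd kc] continuous_map_fst
      by (auto simp: o_def)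
    moreover have "continuous_map (prod_topology T X) X (\<lambda>(g, x). \<phi> g x)"
      using fl by (simp add: flow_def)
    ultimately have "continuous_map (prod_topology T Y) Y
        (h \<circ> ((\<lambda>(g, x). \<phi> g x) \<circ> (\<lambda>z. (fst z, k (snd z)))))"
      using hc by (intro continuous_map_compose)
    then show "continuous_map (prod_topology T Y) Y (\<lambda>(g, y). h (\<phi> g (k y)))"
      by (simp add: o_def case_prod_unfold)
  qed (use T in \<open>auto simp: topY kh flow_one[OF fl] flow_mult[OF fl] flow_closed[OF fl] is_group\<close>)
  have heq: "h (\<phi> g x) = \<psi> g (h x)" if "g \<in> carrier G" "x \<in> ?S" for g x
    using that by (simp add: \<psi>_def topY kh)
  have keq: "k (\<psi> g y) = \<phi> g (k y)" if "g \<in> carrier G" "y \<in> topspace Y" for g y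
    using that by (auto simp: topY kh flow_closed[OF fl] simp flip: heq)
  have "Y closure_of orbit G \<psi> y = topspace Y" if "y \<in> topspace Y" for y
  proof -
    from that have "y \<in> h ` ?S" by (simp only: topY)
    then obtain x where x: "x \<in> ?S" "y = h x" by blast
    have "orbit G \<psi> y = h ` orbit G \<phi> x"
      using x by (auto simp: orbit_def image_iff) (metis heq)+
    moreover have "orbit G \<phi> x \<subseteq> ?S" using x flow_closed[OF fl] by (auto simp: orbit_def)
    ultimately have "Y closure_of orbit G \<psi> y = h ` (X closure_of orbit G \<phi> x)"
      using homeomorphic_map_closure_of[OF homeomorphic_maps_imp_map[OF hk]] by simp
    then show ?thesis using mf x by (simp add: minimal_flow_def topY)
  qed
  then have "minimal_flow G T Y \<psi>" using flY by (simp add: minimal_flow_def)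
  then show ?thesis
    using hk hc kc heq keq unfolding flow_morphism_def by metis
qed

lemma flow_morphism_compose:
  assumes "flow_morphism G X \<phi> Y \<psi> f" "flow_morphism G Y \<psi> Z \<theta> h"
  shows "flow_morphism G X \<phi> Z \<theta> (h \<circ> f)"
proof -
  have "f x \<in> topspace Y" if "x \<in> topspace X" for x
    using assms(1) that continuous_map_funspace by (fastforce simp: flow_morphism_def)
  then show ?thesis
    using assms by (auto simp: flow_morphism_def intro: continuous_map_compose)
qed

lemma flow_morphism_inclusion:
  assumes "C \<subseteq> topspace X"
  shows "flow_morphism G (subtopology X C) (\<lambda>g. restrict (\<phi> g) C) X \<phi> id"
  using assms by (auto simp: flow_morphism_def continuous_map_from_subtopology)

theorem universal_minimal_flow_morphism:
  fixes G :: "('g, 'b) monoid_scheme" and X :: "'x topology"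
  assumes M: "universal_minimal_flow G T M \<phi>" and T: "topspace T = carrier G"
    and X: "flow G T X \<psi>"
  shows "\<exists>f. flow_morphism G M \<phi> X \<psi> f"
proof -
  obtain C where C: "C \<subseteq> topspace X"
    and mC: "minimal_flow G T (subtopology X C) (\<lambda>g. restrict (\<psi> g) C)"
    using minimal_subflow_exists[OF X T] by blast
  obtain Y :: "'g set set topology" and \<theta> h k where "minimal_flow G T Y \<theta>"
    and k: "flow_morphism G Y \<theta> (subtopology X C) (\<lambda>g. restrict (\<psi> g) C) k"
    using minimal_flow_transfer[OF mC T] by blast
  then have "flow G T Y \<theta>" by (simp add: minimal_flow_def)
  then obtain f where "flow_morphism G M \<phi> Y \<theta> f"
    using M unfolding universal_minimal_flow_def by blast
  from flow_morphism_compose[OF flow_morphism_compose[OF this k] flow_morphism_inclusion[OF C]]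
  show ?thesis by blast
qed

theorem universal_minimal_flow_exists:
  fixes G :: "('g, 'b) monoid_scheme"
  assumes "group G" and T: "topspace T = carrier G"
  shows "\<exists>(M :: 'g set set topology) \<phi>. universal_minimal_flow G T M \<phi>"
proof -
  define I where "I = {i :: 'g set set topology \<times> ('g \<Rightarrow> 'g set set \<Rightarrow> 'g set set).
    flow G T (fst i) (snd i)}"
  define P where "P = product_topology fst I"
  define a where "a = (\<lambda>g p. \<lambda>i\<in>I. snd i g (p i))"
  have I: "flow G T (fst i) (snd i)" if "i \<in> I" for i using that by (simp add: I_def)
  have P: "topspace P = (\<Pi>\<^sub>E i\<in>I. topspace (fst i))" by (simp add: P_def)
  have pI: "p i \<in> topspace (fst i)" if "p \<in> topspace P" "i \<in> I" for p i
    using that by (auto simp: P)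
  have flP: "flow G T P (\<lambda>g. restrict (a g) (topspace P))"
  proof (rule flowI)
    show "compact_space P"
      unfolding P_def compact_space_product_topology using I by (auto simp: flow_def)
    show "Hausdorff_space P"
      unfolding P_def Hausdorff_space_product_topology using I by (auto simp: flow_def)
    show "topspace P \<noteq> {}"
      unfolding P PiE_eq_empty_iff using I by (auto simp: flow_def)
    show "a \<one>\<^bsub>G\<^esub> p = p" if "p \<in> topspace P" for p
    proof -
      have "p \<in> extensional I" using that by (auto simp: P PiE_def)
      then show ?thesis
        using that by (intro ext) (auto simp: a_def extensional_def flow_one[OF I pI])
    qed
    show "a (g \<otimes>\<^bsub>G\<^esub> h) p = a g (a h p)" if "g \<in> carrier G" "h \<in> carrier G" "p \<in> topspace P" for g h p
      using that by (intro ext) (auto simp: a_def restrict_def flow_mult[OF I _ _ pI])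
    have "continuous_map (prod_topology T P) (fst i) (\<lambda>z. snd i (fst z) (snd z i))" if i: "i \<in> I" for i
    proof -
      have "continuous_map P (fst i) (\<lambda>p. p i)"
        unfolding P_def using i by (rule continuous_map_product_projection)
      then have "continuous_map (prod_topology T P) (prod_topology T (fst i)) (\<lambda>z. (fst z, snd z i))"
        unfolding continuous_map_paired
        using continuous_map_compose[OF continuous_map_snd, of P "fst i" "\<lambda>p. p i" T] continuous_map_fst
        by (auto simp: o_def)
      moreover have "continuous_map (prod_topology T (fst i)) (fst i) (\<lambda>(g, x). snd i g x)"
        using I[OF i] by (simp add: flow_def)
      ultimately have "continuous_map (prod_topology T P) (fst i)
          ((\<lambda>(g, x). snd i g x) \<circ> (\<lambda>z. (fst z, snd z i)))"
        by (rule continuous_map_compose)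
      then show ?thesis by (simp add: o_def)
    qed
    moreover have "(\<lambda>(g, p). a g p) = (\<lambda>z. \<lambda>i\<in>I. snd i (fst z) (snd z i))"
      by (auto simp: a_def fun_eq_iff)
    ultimately show "continuous_map (prod_topology T P) P (\<lambda>(g, p). a g p)"
      unfolding P_def continuous_map_componentwise by (auto simp: restrict_def extensional_def)
  qed (use assms in auto)
  obtain C where C: "C \<subseteq> topspace P"
    and mC: "minimal_flow G T (subtopology P C) (\<lambda>g. restrict (restrict (a g) (topspace P)) C)"
    using minimal_subflow_exists[OF flP T] by blast
  obtain M :: "'g set set topology" and \<phi> h k where M: "minimal_flow G T M \<phi>"
    and k: "flow_morphism G M \<phi> (subtopology P C) (\<lambda>g. restrict (restrict (a g) (topspace P)) C) k"
    using minimal_flow_transfer[OF mC T] by blast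
  have "\<exists>f. flow_morphism G M \<phi> X \<psi> f" if "flow G T X \<psi>"
    for X :: "'g set set topology" and \<psi>
  proof -
    have i: "(X, \<psi>) \<in> I" using that by (simp add: I_def)
    have "continuous_map P X (\<lambda>p. p (X, \<psi>))"
      using continuous_map_product_projection[OF i, of fst] by (simp add: P_def)
    then have "flow_morphism G P (\<lambda>g. restrict (a g) (topspace P)) X \<psi> (\<lambda>p. p (X, \<psi>))"
      using i by (simp add: flow_morphism_def a_def)
    from flow_morphism_compose[OF flow_morphism_compose[OF k flow_morphism_inclusion[OF C]] this]
    show ?thesis by blast
  qed
  then show ?thesis
    using M by (auto simp: universal_minimal_flow_def)
qed


section \<open>The infinite-dimensional hyperbolic space and its isometry group\<close>

definition hilbert_basis :: "(nat \<Rightarrow> 'h::{real_inner, complete_space}) \<Rightarrow> bool"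
  where "hilbert_basis e \<longleftrightarrow>
    (\<forall>i j. inner (e i) (e j) = (if i = j then 1 else 0)) \<and> closure (span (range e)) = UNIV"

definition hyp_Q :: "(nat \<Rightarrow> 'h::{real_inner, complete_space}) \<Rightarrow> 'h \<Rightarrow> real"
  where "hyp_Q e x = (inner x (e 0))\<^sup>2 - (\<Sum>i. (inner x (e (Suc i)))\<^sup>2)"

definition hyp_form :: "(nat \<Rightarrow> 'h::{real_inner, complete_space}) \<Rightarrow> 'h \<Rightarrow> 'h \<Rightarrow> real"
  where "hyp_form e x y = (hyp_Q e (x + y) - hyp_Q e x - hyp_Q e y) / 2"

definition hyp_space :: "(nat \<Rightarrow> 'h::{real_inner, complete_space}) \<Rightarrow> 'h set"
  where "hyp_space e = {x. hyp_Q e x = 1 \<and> inner x (e 0) > 0}"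

text \<open>
  The distance is characterized by \<open>cosh d(x,y) = (x,y)\<close>, see \<open>cosh_hyp_dist\<close> below.
  The locale \<^locale>\<open>Metric_space\<close> requires nonnegativity and symmetry on the whole type,
  hence the default value outside the hyperbolic space.
\<close>

definition hyp_dist :: "(nat \<Rightarrow> 'h::{real_inner, complete_space}) \<Rightarrow> 'h \<Rightarrow> 'h \<Rightarrow> real"
  where "hyp_dist e x y =
    (if x \<in> hyp_space e \<and> y \<in> hyp_space e then arcosh (hyp_form e x y) else 0)"

text \<open>
  As for \<^const>\<open>BijGroup\<close>, the isometries are surjective and are represented as extensional
  functions, so that distinct elements of the carrier are distinct maps of the hyperbolic space.
\<close>

definition hyp_isometries :: "(nat \<Rightarrow> 'h::{real_inner, complete_space}) \<Rightarrow> ('h \<Rightarrow> 'h) set"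
  where "hyp_isometries e = {f \<in> Bij (hyp_space e).
    \<forall>x\<in>hyp_space e. \<forall>y\<in>hyp_space e. hyp_dist e (f x) (f y) = hyp_dist e x y}"

definition hyp_Isom :: "(nat \<Rightarrow> 'h::{real_inner, complete_space}) \<Rightarrow> ('h \<Rightarrow> 'h) monoid"
  where "hyp_Isom e = BijGroup (hyp_space e)\<lparr>carrier := hyp_isometries e\<rparr>"

text \<open>The topology of pointwise convergence on the hyperbolic space.\<close>

definition hyp_Isom_topology ::
  "(nat \<Rightarrow> 'h::{real_inner, complete_space}) \<Rightarrow> ('h \<Rightarrow> 'h) topology"
  where "hyp_Isom_topology e = subtopology
    (product_topology (\<lambda>_. Metric_space.mtopology (hyp_space e) (hyp_dist e)) (hyp_space e))
    (hyp_isometries e)"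

lemma group_hyp_Isom: "group (hyp_Isom e)"
proof -
  interpret B: group "BijGroup (hyp_space e)" by (rule group_BijGroup)
  let ?S = "hyp_space e"
  have mul: "compose ?S f g \<in> hyp_isometries e"
    if "f \<in> hyp_isometries e" "g \<in> hyp_isometries e" for f g
  proof -
    have "f \<in> Bij ?S" "g \<in> Bij ?S" using that by (auto simp: hyp_isometries_def)
    moreover have "g x \<in> ?S" if "x \<in> ?S" for x
      using Bij_imp_funcset[OF \<open>g \<in> Bij ?S\<close>] that by blast
    ultimately show ?thesis
      using that by (simp add: hyp_isometries_def compose_Bij compose_eq)
  qed
  have iv: "(\<lambda>x\<in>?S. inv_into ?S f x) \<in> hyp_isometries e" if f: "f \<in> hyp_isometries e" for f
  proof -
    have fB: "f \<in> Bij ?S" using f by (auto simp: hyp_isometries_def)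
    have "hyp_dist e (inv_into ?S f x) (inv_into ?S f y) = hyp_dist e x y"
      if "x \<in> ?S" "y \<in> ?S" for x y
    proof -
      have im: "f ` ?S = ?S" using fB by (simp add: Bij_def bij_betw_def)
      have "hyp_dist e (f (inv_into ?S f x)) (f (inv_into ?S f y))
          = hyp_dist e (inv_into ?S f x) (inv_into ?S f y)"
        using f Bij_inv_into_mem[OF fB] that by (simp add: hyp_isometries_def)
      moreover have "f (inv_into ?S f x) = x" "f (inv_into ?S f y) = y"
        using im that by (simp_all add: f_inv_into_f)
      ultimately show ?thesis by simp
    qed
    then show ?thesis
      using restrict_inv_into_Bij[OF fB] by (simp add: hyp_isometries_def)
  qed
  have "subgroup (hyp_isometries e) (BijGroup ?S)"
  proof (rule B.subgroupI)
    show "hyp_isometries e \<subseteq> carrier (BijGroup ?S)"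
      by (auto simp: hyp_isometries_def BijGroup_def)
    have "(\<lambda>x\<in>?S. x) \<in> hyp_isometries e"
      by (simp add: hyp_isometries_def id_Bij)
    then show "hyp_isometries e \<noteq> {}" by blast
  next
    fix f assume f: "f \<in> hyp_isometries e"
    then have "f \<in> Bij ?S" by (auto simp: hyp_isometries_def)
    then show "inv\<^bsub>BijGroup ?S\<^esub> f \<in> hyp_isometries e"
      using iv[OF f] by (simp add: inv_BijGroup)
  next
    fix f g assume "f \<in> hyp_isometries e" "g \<in> hyp_isometries e"
    then show "f \<otimes>\<^bsub>BijGroup ?S\<^esub> g \<in> hyp_isometries e"
      using mul[of f g] by (simp add: BijGroup_def hyp_isometries_def)
  qed
  then show ?thesis
    unfolding hyp_Isom_def by (rule B.subgroup_imp_group)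
qed

lemma hilbert_basis_sums:
  assumes e: "hilbert_basis e"
  shows "(\<lambda>i. (inner x (e i))\<^sup>2) sums (inner x x)"
proof -
  have on: "inner (e i) (e j) = (if i = j then 1 else 0)" for i j
    using e by (simp add: hilbert_basis_def)
  define s where "s = (\<lambda>n. \<Sum>i<n. inner x (e i) *\<^sub>R e i)"
  have se: "inner (s n) (e j) = (if j < n then inner x (e j) else 0)" for n j
  proof -
    have "inner (s n) (e j) = (\<Sum>i<n. if i = j then inner x (e j) else 0)"
      unfolding s_def inner_sum_left by (rule sum.cong) (auto simp: on)
    then show ?thesis by simp
  qed
  have ss: "inner v (s n) = (\<Sum>i<n. inner x (e i) * inner v (e i))" for n v
    by (simp add: s_def inner_sum_right)
  have err: "(norm (x - s n))\<^sup>2 = inner x x - (\<Sum>i<n. (inner x (e i))\<^sup>2)" for n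
  proof -
    have "inner (s n) (s n) = (\<Sum>i<n. (inner x (e i))\<^sup>2)"
      unfolding ss by (rule sum.cong) (auto simp: se power2_eq_square)
    moreover have "inner x (s n) = (\<Sum>i<n. (inner x (e i))\<^sup>2)"
      unfolding ss by (simp add: power2_eq_square)
    ultimately show ?thesis
      by (simp add: power2_norm_eq_inner inner_diff_left inner_diff_right inner_commute[of "s n" x])
  qed
  have best: "norm (x - s n) \<le> norm (x - y)" if y: "y \<in> span (e ` {..<n})" for n y
  proof -
    have "inner (x - s n) w = 0" if "w \<in> span (e ` {..<n})" for w
      using that
    proof (induction rule: span_induct_alt)
      case (step c b w)
      then obtain j where "b = e j" "j < n" by blast
      then have "inner (x - s n) b = 0" by (simp add: inner_diff_left se)
      then show ?case using step.IH by (simp add: inner_add_right)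
    qed simp
    moreover have "s n \<in> span (e ` {..<n})"
      unfolding s_def by (intro span_sum span_scale span_base) auto
    then have "s n - y \<in> span (e ` {..<n})" using y by (rule span_diff)
    ultimately have "orthogonal (x - s n) (s n - y)" by (simp add: orthogonal_def)
    then have "(norm ((x - s n) + (s n - y)))\<^sup>2 = (norm (x - s n))\<^sup>2 + (norm (s n - y))\<^sup>2"
      by (rule norm_add_Pythagorean)
    moreover have "(x - s n) + (s n - y) = x - y" by simp
    ultimately have "(norm (x - s n))\<^sup>2 \<le> (norm (x - y))\<^sup>2"
      by (metis le_add_same_cancel1 zero_le_power2)
    then show ?thesis by (rule power2_le_imp_le) simp
  qed
  have "(\<lambda>n. norm (x - s n)) \<longlonglongrightarrow> 0"
  proof (rule LIMSEQ_I)
    fix r :: real assume "r > 0"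
    moreover have "x \<in> closure (span (range e))" using e by (simp add: hilbert_basis_def)
    ultimately obtain y where y: "y \<in> span (range e)" "dist y x < r"
      unfolding closure_approachable by blast
    from y(1) obtain S c where S: "finite S" "S \<subseteq> range e" "y = (\<Sum>a\<in>S. c a *\<^sub>R a)"
      unfolding span_explicit by force
    from finite_subset_image[OF S(1,2)] obtain J where J: "finite J" "S = e ` J" by blast
    then obtain N where N: "J \<subseteq> {..<N}" using finite_nat_iff_bounded by auto
    have "norm (norm (x - s n) - 0) < r" if "n \<ge> N" for n
    proof -
      have "S \<subseteq> e ` {..<n}" using J N that by auto
      then have "y \<in> span (e ` {..<n})"
        unfolding S(3) by (intro span_sum span_scale span_base) auto
      from best[OF this] show ?thesis using y(2) by (simp add: dist_norm norm_minus_commute)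
    qed
    then show "\<exists>N. \<forall>n\<ge>N. norm (norm (x - s n) - 0) < r" by blast
  qed
  then have "(\<lambda>n. (norm (x - s n))\<^sup>2) \<longlonglongrightarrow> 0\<^sup>2" by (rule tendsto_power)
  then have "(\<lambda>n. inner x x - (norm (x - s n))\<^sup>2) \<longlonglongrightarrow> inner x x - 0\<^sup>2"
    by (intro tendsto_diff tendsto_const)
  then show ?thesis by (simp add: sums_def err)
qed

lemma hyp_Q_eq:
  assumes "hilbert_basis e"
  shows "hyp_Q e x = 2 * (inner x (e 0))\<^sup>2 - inner x x"
proof -
  have "(\<lambda>i. (inner x (e (Suc i)))\<^sup>2) sums (inner x x - (inner x (e 0))\<^sup>2)"
    using hilbert_basis_sums[OF assms, of x] by (subst sums_Suc_iff) simp
  then show ?thesis by (simp add: hyp_Q_def sums_iff)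
qed

lemma hyp_form_eq:
  assumes "hilbert_basis e"
  shows "hyp_form e x y = 2 * inner x (e 0) * inner y (e 0) - inner x y"
  by (simp add: hyp_form_def hyp_Q_eq[OF assms] inner_add_left inner_add_right
      inner_commute[of y x] power2_eq_square field_simps)

lemma hyp_form_linear:
  assumes "hilbert_basis e"
  shows "hyp_form e (x - c *\<^sub>R y) z = hyp_form e x z - c * hyp_form e y z"
    and "hyp_form e z (x - c *\<^sub>R y) = hyp_form e z x - c * hyp_form e z y"
  by (simp_all add: hyp_form_eq[OF assms] inner_diff_left inner_diff_right algebra_simps)

lemma hyp_form_commute: "hyp_form e x y = hyp_form e y x"
  by (simp add: hyp_form_def add.commute)

lemma hyp_form_self:
  assumes "hilbert_basis e"
  shows "hyp_form e x x = hyp_Q e x"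
  by (simp add: hyp_form_eq[OF assms] hyp_Q_eq[OF assms] power2_eq_square)

lemma hyp_form_split:
  assumes e: "hilbert_basis e"
  obtains u v where "hyp_form e x y = inner x (e 0) * inner y (e 0) - inner u v"
    and "hyp_Q e x = (inner x (e 0))\<^sup>2 - (norm u)\<^sup>2"
    and "hyp_Q e y = (inner y (e 0))\<^sup>2 - (norm v)\<^sup>2"
    and "x = inner x (e 0) *\<^sub>R e 0 + u" and "y = inner y (e 0) *\<^sub>R e 0 + v"
proof
  let ?u = "x - inner x (e 0) *\<^sub>R e 0" and ?v = "y - inner y (e 0) *\<^sub>R e 0"
  have "inner (e 0) (e 0) = 1" using e by (simp add: hilbert_basis_def)
  then show "hyp_form e x y = inner x (e 0) * inner y (e 0) - inner ?u ?v"
    "hyp_Q e x = (inner x (e 0))\<^sup>2 - (norm ?u)\<^sup>2"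
    "hyp_Q e y = (inner y (e 0))\<^sup>2 - (norm ?v)\<^sup>2"
    unfolding power2_norm_eq_inner
    by (simp_all add: hyp_form_eq[OF e] hyp_Q_eq[OF e] inner_diff_left inner_diff_right
        inner_commute[of "e 0" x] inner_commute[of "e 0" y] power2_eq_square algebra_simps)
qed simp_all

lemma hyp_form_ge_1:
  assumes e: "hilbert_basis e" and x: "x \<in> hyp_space e" and y: "y \<in> hyp_space e"
  shows "hyp_form e x y \<ge> 1" and "hyp_form e x y = 1 \<longleftrightarrow> x = y"
proof -
  obtain u v where *: "hyp_form e x y = inner x (e 0) * inner y (e 0) - inner u v"
      "hyp_Q e x = (inner x (e 0))\<^sup>2 - (norm u)\<^sup>2" "hyp_Q e y = (inner y (e 0))\<^sup>2 - (norm v)\<^sup>2"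
      "x = inner x (e 0) *\<^sub>R e 0 + u" "y = inner y (e 0) *\<^sub>R e 0 + v"
    using hyp_form_split[OF e] .
  define a b where "a = inner x (e 0)" and "b = inner y (e 0)"
  have a: "a > 0" "a\<^sup>2 = 1 + (norm u)\<^sup>2" and b: "b > 0" "b\<^sup>2 = 1 + (norm v)\<^sup>2"
    using x y *(2,3) by (auto simp: hyp_space_def a_def b_def)
  have a1: "1 \<le> a" by (rule power2_le_imp_le) (use a in simp_all)
  have b1: "1 \<le> b" by (rule power2_le_imp_le) (use b in simp_all)
  have sq: "(a * b - 1)\<^sup>2 = (norm u * norm v)\<^sup>2 + (a - b)\<^sup>2"
  proof -
    have "(norm u * norm v)\<^sup>2 = (a\<^sup>2 - 1) * (b\<^sup>2 - 1)" using a b by (simp add: power_mult_distrib)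
    then show ?thesis by (simp add: power2_eq_square algebra_simps)
  qed
  have ab: "a * b - 1 \<ge> 0" using mult_mono[OF a1 b1] a by simp
  have le: "norm u * norm v \<le> a * b - 1"
    by (rule power2_le_imp_le[OF _ ab]) (simp add: sq)
  have cs: "inner u v \<le> norm u * norm v" by (rule norm_cauchy_schwarz)
  show "hyp_form e x y \<ge> 1" using le cs *(1) by (simp add: a_def b_def)
  show "hyp_form e x y = 1 \<longleftrightarrow> x = y"
  proof
    assume "hyp_form e x y = 1"
    then have eq: "inner u v = a * b - 1" using *(1) by (simp add: a_def b_def)
    then have "a * b - 1 = norm u * norm v" using le cs by simp
    then have "a = b" using sq by simp
    have "(norm (u - v))\<^sup>2 = (norm u)\<^sup>2 + (norm v)\<^sup>2 - 2 * inner u v"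
      by (simp add: power2_norm_eq_inner inner_diff_left inner_diff_right inner_commute[of v u])
    also have "\<dots> = (a - b)\<^sup>2"
      unfolding eq power2_diff a(2) b(2) by simp
    finally have "(norm (u - v))\<^sup>2 = 0" using \<open>a = b\<close> by simp
    then have "u = v" by simp
    moreover have "x = a *\<^sub>R e 0 + u" "y = b *\<^sub>R e 0 + v"
      unfolding a_def b_def by (fact *(4), fact *(5))
    ultimately show "x = y" using \<open>a = b\<close> by metis
  next
    assume "x = y"
    then show "hyp_form e x y = 1" using x by (simp add: hyp_form_self[OF e] hyp_space_def)
  qed
qed

lemma cosh_hyp_dist:
  assumes "hilbert_basis e" "x \<in> hyp_space e" "y \<in> hyp_space e"
  shows "cosh (hyp_dist e x y) = hyp_form e x y"
  using hyp_form_ge_1[OF assms] assms by (simp add: hyp_dist_def)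

lemma hyp_Q_orthogonal_nonpos:
  assumes e: "hilbert_basis e" and y: "y \<in> hyp_space e" and 0: "hyp_form e w y = 0"
  shows "hyp_Q e w \<le> 0"
proof (rule ccontr)
  assume pos: "\<not> hyp_Q e w \<le> 0"
  obtain u v where *: "hyp_form e w y = inner w (e 0) * inner y (e 0) - inner u v"
      "hyp_Q e w = (inner w (e 0))\<^sup>2 - (norm u)\<^sup>2" "hyp_Q e y = (inner y (e 0))\<^sup>2 - (norm v)\<^sup>2"
      and "w = inner w (e 0) *\<^sub>R e 0 + u" "y = inner y (e 0) *\<^sub>R e 0 + v"
    using hyp_form_split[OF e] .
  define c b where "c = inner w (e 0)" and "b = inner y (e 0)"
  have b: "b\<^sup>2 = 1 + (norm v)\<^sup>2" using y * by (auto simp: hyp_space_def b_def)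
  have c: "(norm u)\<^sup>2 < c\<^sup>2" using pos * by (simp add: c_def)
  have "c * b = inner u v" using 0 * by (simp add: c_def b_def)
  then have "(c * b)\<^sup>2 \<le> (norm u * norm v)\<^sup>2"
    using Cauchy_Schwarz_ineq2[of u v] by (simp flip: abs_le_square_iff add: abs_mult)
  then have "c\<^sup>2 * (1 + (norm v)\<^sup>2) \<le> (norm u)\<^sup>2 * (norm v)\<^sup>2"
    by (simp add: power_mult_distrib b)
  also have "\<dots> \<le> c\<^sup>2 * (norm v)\<^sup>2" using c by (intro mult_right_mono) auto
  finally have "c\<^sup>2 \<le> 0" by (simp add: algebra_simps)
  then show False using c zero_le_power2[of "norm u"] by linarith
qed

theorem Metric_space_hyp:
  assumes e: "hilbert_basis e"
  shows "Metric_space (hyp_space e) (hyp_dist e)"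
proof -
  have tri: "hyp_dist e x z \<le> hyp_dist e x y + hyp_dist e y z"
    if x: "x \<in> hyp_space e" and y: "y \<in> hyp_space e" and z: "z \<in> hyp_space e" for x y z
  proof -
    define \<alpha> \<beta> where "\<alpha> = hyp_form e x y" and "\<beta> = hyp_form e y z"
    have ge: "\<alpha> \<ge> 1" "\<beta> \<ge> 1" using hyp_form_ge_1(1)[OF e] x y z by (auto simp: \<alpha>_def \<beta>_def)
    define p q where "p = x - \<alpha> *\<^sub>R y" and "q = z - \<beta> *\<^sub>R y"
    have one: "hyp_form e x x = 1" "hyp_form e y y = 1" "hyp_form e z z = 1"
      using x y z by (auto simp: hyp_form_self[OF e] hyp_space_def)
    note simps = hyp_form_linear[OF e] one hyp_form_commute[of e z y] hyp_form_commute[of e y x]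
    have A: "hyp_form e p p = 1 - \<alpha>\<^sup>2" and C: "hyp_form e q q = 1 - \<beta>\<^sup>2"
      and D: "hyp_form e p q = hyp_form e x z - \<alpha> * \<beta>"
      and py: "hyp_form e p y = 0" and qy: "hyp_form e q y = 0"
      unfolding p_def q_def simps \<alpha>_def[symmetric] \<beta>_def[symmetric]
      by (simp_all add: power2_eq_square algebra_simps)
    define d where "d = hyp_form e p q"
    have "d\<^sup>2 \<le> (\<alpha>\<^sup>2 - 1) * (\<beta>\<^sup>2 - 1)"
    proof (cases "\<alpha> = 1")
      case True
      then have "x = y" using hyp_form_ge_1(2)[OF e x y] by (simp add: \<alpha>_def)
      then have "d = 0" using True by (simp add: d_def D \<beta>_def)
      then show ?thesis using True by simp
    next
      case False
      then have pos: "\<alpha>\<^sup>2 - 1 > 0" using ge by (simp add: power2_eq_square less_1_mult)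
      define w where "w = (\<alpha>\<^sup>2 - 1) *\<^sub>R q - (- d) *\<^sub>R p"
      have w: "hyp_form e w v = (\<alpha>\<^sup>2 - 1) * hyp_form e q v + d * hyp_form e p v" for v
        by (simp add: w_def hyp_form_eq[OF e] inner_diff_left inner_add_left algebra_simps)
      have "hyp_form e w y = 0" by (simp add: w py qy)
      then have "hyp_form e w w \<le> 0"
        using hyp_Q_orthogonal_nonpos[OF e y] by (simp add: hyp_form_self[OF e])
      moreover have "hyp_form e w w = (\<alpha>\<^sup>2 - 1) * (d\<^sup>2 - (\<alpha>\<^sup>2 - 1) * (\<beta>\<^sup>2 - 1))"
      proof -
        have qw: "hyp_form e q w = (\<alpha>\<^sup>2 - 1) * (1 - \<beta>\<^sup>2) + d * d"
          using w[of q] by (simp only: C d_def hyp_form_commute[of e q w])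
        have pw: "hyp_form e p w = (\<alpha>\<^sup>2 - 1) * d + d * (1 - \<alpha>\<^sup>2)"
          using w[of p] by (simp only: A d_def hyp_form_commute[of e p w] hyp_form_commute[of e q p])
        show ?thesis
          unfolding w[of w] qw pw by (simp add: power2_eq_square algebra_simps)
      qed
      ultimately show ?thesis using pos by (simp add: mult_le_0_iff)
    qed
    then have "sqrt (d\<^sup>2) \<le> sqrt ((\<alpha>\<^sup>2 - 1) * (\<beta>\<^sup>2 - 1))"
      by (rule real_sqrt_le_mono)
    then have "\<bar>d\<bar> \<le> sqrt (\<alpha>\<^sup>2 - 1) * sqrt (\<beta>\<^sup>2 - 1)"
      by (simp only: real_sqrt_abs real_sqrt_mult)
    then have "hyp_form e x z \<le> \<alpha> * \<beta> + sqrt (\<alpha>\<^sup>2 - 1) * sqrt (\<beta>\<^sup>2 - 1)"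
      unfolding d_def D by linarith
    also have "\<dots> = cosh (arcosh \<alpha> + arcosh \<beta>)"
      using ge by (simp add: cosh_add sinh_arcosh_real)
    finally have "cosh (hyp_dist e x z) \<le> cosh (hyp_dist e x y + hyp_dist e y z)"
      using cosh_hyp_dist[OF e x z] x y z by (simp add: hyp_dist_def \<alpha>_def \<beta>_def)
    moreover have "hyp_dist e x z \<ge> 0" "hyp_dist e x y + hyp_dist e y z \<ge> 0"
      using hyp_form_ge_1(1)[OF e] x y z by (auto simp: hyp_dist_def intro!: add_nonneg_nonneg)
    ultimately show ?thesis by (simp add: cosh_real_nonneg_le_iff)
  qed
  show ?thesis
  proof
    show "hyp_dist e x y \<ge> 0" for x y
      using hyp_form_ge_1(1)[OF e] by (simp add: hyp_dist_def)
    show "hyp_dist e x y = hyp_dist e y x" for x y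
      by (simp add: hyp_dist_def hyp_form_commute)
    show "hyp_dist e x y = 0 \<longleftrightarrow> x = y" if "x \<in> hyp_space e" "y \<in> hyp_space e" for x y
      using that hyp_form_ge_1[OF e that] by (simp add: hyp_dist_def)
  qed (rule tri)
qed

lemma topspace_hyp_Isom_topology:
  assumes "hilbert_basis e"
  shows "topspace (hyp_Isom_topology e) = carrier (hyp_Isom e)"
proof -
  have "hyp_isometries e \<subseteq> (\<Pi>\<^sub>E x\<in>hyp_space e. hyp_space e)"
    unfolding hyp_isometries_def PiE_def using Bij_imp_funcset Bij_imp_extensional by blast
  then show ?thesis
    by (auto simp: hyp_Isom_topology_def hyp_Isom_def
        Metric_space.topspace_mtopology[OF Metric_space_hyp[OF assms]])
qed

corollary hyp_Isom_universal_minimal_flow_exists: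
  fixes e :: "nat \<Rightarrow> 'h::{real_inner, complete_space}"
  assumes "hilbert_basis e"
  shows "\<exists>(M :: ('h \<Rightarrow> 'h) set set topology) \<phi>.
    universal_minimal_flow (hyp_Isom e) (hyp_Isom_topology e) M \<phi>"
  by (rule universal_minimal_flow_exists[OF group_hyp_Isom topspace_hyp_Isom_topology[OF assms]])

end

theory Submission
  imports Defs
begin

text \<open>
  The universal minimal flow maps to every flow, so it suffices to find one flow whose pullback
  yields uncountably many continuous functions that stay at mutual sup-distance at least 1;
  a compact metrizable space carries only countably many such functions.

  The group acts on the closed ball, i.e. on the solid light cone modulo positive scalars. For a
  cone point \<open>v\<close> with \<open>(e 0, v) = 1\<close>, the number \<open>(e 0, g v)\<close> is a continuous multiplicative cocycle.
  Extending the ball by a circle for every real frequency \<open>s\<close>, rotated by \<open>(e 0, g v)\<^sup>i\<^sup>s\<close>, gives a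
  compact flow. In every direction from the base point or its opposite the linear form of \<open>v\<close> grows
  at least like \<open>cosh\<close>, so on each orbit the cocycle takes all values in \<open>[1, \<infinity>)\<close>, and the circle
  coordinates of two different frequencies become far apart somewhere on the orbit.
\<close>

section \<open>Separated families of continuous functions\<close>

text \<open>Total boundedness covers the space by finitely many balls of radius
  \<open>1 / real (Suc n)\<close> for every \<open>n\<close>; all these balls together form a
  countable base.\<close>

lemma compact_metrizable_imp_second_countable:
  assumes "compact_space X" "metrizable_space X"
  shows "second_countable X"
proof -
  obtain M d where "Metric_space M d" and X: "X = Metric_space.mtopology M d"
    using assms(2) by (auto simp: metrizable_space_def)
  then interpret Metric_space M d by simp
  have "mtotally_bounded M"
    using assms(1) compact_space_eq_mcomplete_mtotally_bounded X by blast
  then have "\<forall>n. \<exists>K. finite K \<and> K \<subseteq> M \<and> M \<subseteq> (\<Union>x\<in>K. mball x (1 / real (Suc n)))"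
    by (simp add: mtotally_bounded_def)
  then obtain K where K: "\<forall>n. finite (K n) \<and> K n \<subseteq> M \<and> M \<subseteq> (\<Union>x\<in>K n. mball x (1 / real (Suc n)))"
    by (rule choice[THEN exE])
  define \<B> where "\<B> = (\<Union>n. (\<lambda>x. mball x (1 / real (Suc n))) ` K n)"
  have "\<exists>V\<in>\<B>. x \<in> V \<and> V \<subseteq> U" if U: "openin X U" "x \<in> U" for U x
  proof -
    obtain r where r: "r > 0" "mball x r \<subseteq> U" and x: "x \<in> M"
      using U unfolding X openin_mtopology by blast
    \<comment> \<open>Half of \<open>r\<close>, because a ball of radius below \<open>r / 2\<close>
      that contains \<open>x\<close>, whatever its centre, lies in the \<open>r\<close>-ball around
      \<open>x\<close>.\<close>
    obtain n where n: "1 / real (Suc n) < r / 2"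
      using nat_approx_posE[of "r / 2"] r by auto
    obtain y where y: "y \<in> K n" "x \<in> mball y (1 / real (Suc n))"
      using K x by blast
    have "mball y (1 / real (Suc n)) \<subseteq> mball x r"
    proof
      fix z assume "z \<in> mball y (1 / real (Suc n))"
      then show "z \<in> mball x r"
        using y(2) n triangle[of x y z] commute[of x y] by (simp del: of_nat_Suc)
    qed
    moreover have "mball y (1 / real (Suc n)) \<in> \<B>" using y(1) by (auto simp: \<B>_def)
    ultimately show ?thesis using y(2) r(2) by blast
  qed
  moreover have "countable \<B>"
    unfolding \<B>_def using K by (intro countable_UN countable_finite[OF finite_imageI]) auto
  moreover have "openin X V" if "V \<in> \<B>" for V
    using that by (auto simp: \<B>_def X)
  ultimately show ?thesis
    unfolding second_countable_def by blast
qed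

text \<open>Each map is encoded by a finite set of pairs: a basic open set, and a point of a
  countable dense set that approximates the map there up to \<open>r / 2\<close>. Two maps with a
  common code are closer than \<open>r\<close> at every point, so the code is injective, and there
  are only countably many codes.\<close>

lemma countable_separated_continuous_maps:
  fixes F :: "'i \<Rightarrow> 'a \<Rightarrow> 'b::{metric_space, second_countable_topology}"
  assumes X: "compact_space X" "second_countable X" and "r > 0"
    and F: "\<And>i. i \<in> I \<Longrightarrow> continuous_map X euclidean (F i)"
    and sep: "\<And>i j. i \<in> I \<Longrightarrow> j \<in> I \<Longrightarrow> i \<noteq> j \<Longrightarrow> \<exists>x\<in>topspace X. dist (F i x) (F j x) \<ge> r"
  shows "countable I"
proof -
  obtain \<B> where \<B>: "countable \<B>" "\<And>V. V \<in> \<B> \<Longrightarrow> openin X V"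
      "\<And>U x. openin X U \<Longrightarrow> x \<in> U \<Longrightarrow> \<exists>V\<in>\<B>. x \<in> V \<and> V \<subseteq> U"
    using X(2) by (auto simp: second_countable_def)
  obtain Q :: "'b set" where Q: "countable Q" "\<And>U. open U \<Longrightarrow> U \<noteq> {} \<Longrightarrow> \<exists>q\<in>Q. q \<in> U"
    using countable_dense_setE by blast
  define good where "good = (\<lambda>i D. topspace X \<subseteq> (\<Union>p\<in>D. fst p) \<and>
    (\<forall>p\<in>D. \<forall>x\<in>fst p. dist (F i x) (snd p) < r / 2))"
  have "\<exists>D. finite D \<and> D \<subseteq> \<B> \<times> Q \<and> good i D" if i: "i \<in> I" for i
  proof -
    \<comment> \<open>These are all admissible pairs for \<open>F i\<close>; compactness extracts
      finitely many whose open sets still cover.\<close>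
    define E where "E = {p \<in> \<B> \<times> Q. \<forall>x\<in>fst p. dist (F i x) (snd p) < r / 2}"
    have "x \<in> \<Union>(fst ` E)" if x: "x \<in> topspace X" for x
    proof -
      obtain q where q: "q \<in> Q" "q \<in> ball (F i x) (r / 2)"
        using Q(2)[of "ball (F i x) (r / 2)"] \<open>r > 0\<close> by auto
      have "openin X {y \<in> topspace X. F i y \<in> ball q (r / 2)}"
        using openin_continuous_map_preimage[OF F[OF i], of "ball q (r / 2)"]
        by (simp del: mem_ball)
      moreover have "x \<in> {y \<in> topspace X. F i y \<in> ball q (r / 2)}"
        using q x by (simp add: dist_commute)
      ultimately obtain V where "V \<in> \<B>" "x \<in> V" "V \<subseteq> {y \<in> topspace X. F i y \<in> ball q (r / 2)}"
        using \<B>(3) by blast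
      then have "(V, q) \<in> E" "x \<in> fst (V, q)" using q by (auto simp: E_def dist_commute)
      then show ?thesis by blast
    qed
    moreover have "openin X V" if "V \<in> fst ` E" for V
      using that \<B>(2) by (auto simp: E_def)
    ultimately obtain \<F> where \<F>: "finite \<F>" "\<F> \<subseteq> fst ` E" "topspace X \<subseteq> \<Union>\<F>"
      using X(1) unfolding compact_space_alt by (metis subsetI)
    obtain D where "D \<subseteq> E" "finite D" "\<F> = fst ` D"
      using finite_subset_image[OF \<F>(1,2)] by blast
    then show ?thesis
      using \<F>(3) by (intro exI[of _ D]) (auto simp: good_def E_def)
  qed
  then obtain D where D: "\<And>i. i \<in> I \<Longrightarrow> finite (D i) \<and> D i \<subseteq> \<B> \<times> Q \<and> good i (D i)"
    by metis
  have "inj_on D I"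
  proof (rule inj_onI, rule ccontr)
    fix i j assume ij: "i \<in> I" "j \<in> I" "D i = D j" "i \<noteq> j"
    obtain x where x: "x \<in> topspace X" "dist (F i x) (F j x) \<ge> r" using sep ij by blast
    then obtain p where "p \<in> D i" "x \<in> fst p" using D[OF ij(1)] by (auto simp: good_def)
    then have "dist (F i x) (snd p) < r / 2" "dist (F j x) (snd p) < r / 2"
      using D[OF ij(1)] D[OF ij(2)] ij(3) by (auto simp: good_def)
    then show False using x(2) dist_triangle2[of "F i x" "F j x" "snd p"] by linarith
  qed
  moreover have "countable (D ` I)"
  proof (rule countable_subset)
    show "D ` I \<subseteq> {A. finite A \<and> A \<subseteq> \<B> \<times> Q}" using D by auto
    show "countable {A. finite A \<and> A \<subseteq> \<B> \<times> Q}"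
      using \<B>(1) Q(1) by (intro countable_Collect_finite_subset) simp
  qed
  ultimately show ?thesis by (rule countable_image_inj_on[rotated])
qed

section \<open>Midpoints and point reflections in the hyperbolic space\<close>

text \<open>The hyperboloid \<open>hyp_Q e w = 1\<close> has two sheets. On the lower one
  \<open>- w\<close> would lie in the hyperbolic space, and the form of \<open>w\<close> with
  \<open>m\<close> would be at most \<open>-1\<close>.\<close>

lemma hyp_space_sign:
  assumes e: "hilbert_basis e" and m: "m \<in> hyp_space e"
    and "hyp_Q e w = 1" "hyp_form e w m > 0"
  shows "w \<in> hyp_space e"
proof (rule ccontr)
  assume "w \<notin> hyp_space e"
  then have le: "inner w (e 0) \<le> 0" using assms(3) by (simp add: hyp_space_def)
  have "2 * (inner w (e 0))\<^sup>2 = 1 + inner w w"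
    using assms(3) by (simp add: hyp_Q_eq[OF e])
  \<comment> \<open>The square is at least 1/2, so \<open>w\<close> cannot lie between the two
    sheets.\<close>
  then have "inner w (e 0) \<noteq> 0"
    by (smt (verit) inner_ge_zero mult_zero_right power_zero_numeral)
  then have "- w \<in> hyp_space e"
    using le assms(3) by (simp add: hyp_space_def hyp_Q_eq[OF e])
  from hyp_form_ge_1(1)[OF e this m] have "hyp_form e w m \<le> -1"
    by (simp add: hyp_form_eq[OF e])
  then show False using assms(4) by simp
qed

text \<open>With \<open>c = cosh r\<close> the hypotheses say that \<open>m\<close> is at distance
  \<open>r\<close> from both points and that these are \<open>2 * r\<close> apart. The vector
  \<open>x + y\<close>, scaled onto the hyperboloid, has form 1 with \<open>m\<close>, which forces
  it to be \<open>m\<close>.\<close>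

lemma hyp_midpoint:
  assumes e: "hilbert_basis e" and x: "x \<in> hyp_space e" and y: "y \<in> hyp_space e"
    and m: "m \<in> hyp_space e"
    and c: "hyp_form e x m = c" "hyp_form e y m = c" "hyp_form e x y = 2 * c\<^sup>2 - 1"
  shows "x + y = (2 * c) *\<^sub>R m"
proof -
  have c1: "c \<ge> 1" using hyp_form_ge_1(1)[OF e x m] c by simp
  define w where "w = (1 / (2 * c)) *\<^sub>R (x + y)"
  have lin: "hyp_form e w z = (hyp_form e x z + hyp_form e y z) / (2 * c)" for z
    using c1 by (simp add: w_def hyp_form_eq[OF e] inner_add_left field_simps)
  have wm: "hyp_form e w m = 1" using lin[of m] c c1 by simp
  have "hyp_form e w x = c" "hyp_form e w y = c"
    using c c1 x y lin[of x] lin[of y] hyp_form_self[OF e, of x] hyp_form_self[OF e, of y]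
    by (simp_all add: hyp_space_def hyp_form_commute[of e y x] power2_eq_square)
  then have "hyp_form e w w = 1"
    using lin[of w] c1 by (simp add: hyp_form_commute[of e x w] hyp_form_commute[of e y w])
  then have "hyp_Q e w = 1" by (simp add: hyp_form_self[OF e])
  then have "w \<in> hyp_space e" using hyp_space_sign[OF e m] wm by simp
  then have "w = m" using hyp_form_ge_1(2)[OF e _ m] wm by simp
  then have "(2 * c) *\<^sub>R m = (2 * c) *\<^sub>R w" by simp
  also have "\<dots> = x + y" using c1 by (simp add: w_def)
  finally show ?thesis by simp
qed

lemma hyp_isometriesI:
  assumes e: "hilbert_basis e" and f: "f \<in> Bij (hyp_space e)"
    and "\<And>x y. x \<in> hyp_space e \<Longrightarrow> y \<in> hyp_space e \<Longrightarrow> hyp_form e (f x) (f y) = hyp_form e x y"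
  shows "f \<in> hyp_isometries e"
  using assms Bij_imp_funcset[OF f] by (auto simp: hyp_isometries_def hyp_dist_def)

text \<open>This is the restriction of the linear map that fixes \<open>m\<close> and is -1 on the
  orthogonal complement of \<open>m\<close> with respect to \<open>hyp_form\<close>. It preserves
  the form and is its own inverse.\<close>

lemma point_reflection_isometry:
  assumes e: "hilbert_basis e" and m: "m \<in> hyp_space e"
  shows "(\<lambda>x\<in>hyp_space e. (2 * hyp_form e x m) *\<^sub>R m - x) \<in> hyp_isometries e"
proof -
  let ?H = "hyp_space e"
  define s where "s = (\<lambda>x. (2 * hyp_form e x m) *\<^sub>R m - x)"
  have mm: "hyp_form e m m = 1" using m by (simp add: hyp_space_def hyp_form_self[OF e])
  have lin: "hyp_form e (s x) z = 2 * hyp_form e x m * hyp_form e m z - hyp_form e x z" for x z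
    by (simp add: s_def hyp_form_eq[OF e] inner_diff_left algebra_simps)
  have sm: "hyp_form e (s x) m = hyp_form e x m" for x
    by (simp add: lin mm)
  have form: "hyp_form e (s x) (s y) = hyp_form e x y" for x y
    using lin[of x "s y"] lin[of y x] sm[of y]
    by (simp add: hyp_form_commute[of e m "s y"] hyp_form_commute[of e x "s y"]
        hyp_form_commute[of e y x] hyp_form_commute[of e m x])
  have inH: "s x \<in> ?H" if x: "x \<in> ?H" for x
  proof (rule hyp_space_sign[OF e m])
    show "hyp_Q e (s x) = 1"
      using form[of x x] x by (simp add: hyp_form_self[OF e] hyp_space_def)
    show "hyp_form e (s x) m > 0" using sm[of x] hyp_form_ge_1(1)[OF e x m] by simp
  qed
  have inv: "s (s x) = x" for x
  proof -
    have "s (s x) = (2 * hyp_form e (s x) m) *\<^sub>R m - s x" by (simp only: s_def)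
    then show ?thesis unfolding sm by (simp add: s_def)
  qed
  have "bij_betw s ?H ?H"
    by (rule bij_betw_byWitness[where f' = s]) (auto simp: inv inH)
  then have "bij_betw (restrict s ?H) ?H ?H"
    by (simp add: bij_betw_restrict_eq)
  then have "restrict s ?H \<in> hyp_isometries e"
    by (intro hyp_isometriesI[OF e]) (auto simp: Bij_def form)
  then show ?thesis by (simp only: s_def)
qed

section \<open>Isometries and a geodesic\<close>

lemma
  shows hyp_Isom_mult: "g \<in> carrier (hyp_Isom e) \<Longrightarrow> h \<in> carrier (hyp_Isom e) \<Longrightarrow> x \<in> hyp_space e
      \<Longrightarrow> (g \<otimes>\<^bsub>hyp_Isom e\<^esub> h) x = g (h x)"
    and hyp_Isom_one: "x \<in> hyp_space e \<Longrightarrow> \<one>\<^bsub>hyp_Isom e\<^esub> x = x"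
    and hyp_Isom_closed: "g \<in> carrier (hyp_Isom e) \<Longrightarrow> x \<in> hyp_space e \<Longrightarrow> g x \<in> hyp_space e"
    and hyp_Isom_dist: "g \<in> carrier (hyp_Isom e) \<Longrightarrow> x \<in> hyp_space e \<Longrightarrow> y \<in> hyp_space e
      \<Longrightarrow> hyp_dist e (g x) (g y) = hyp_dist e x y"
  using Bij_imp_funcset[of g "hyp_space e"]
  by (auto simp: hyp_Isom_def BijGroup_def hyp_isometries_def compose_eq)

lemma hyp_Isom_inv_closed: "g \<in> carrier (hyp_Isom e) \<Longrightarrow> inv\<^bsub>hyp_Isom e\<^esub> g \<in> carrier (hyp_Isom e)"
  by (rule group.inv_closed[OF group_hyp_Isom])

lemma hyp_Isom_inv:
  assumes "g \<in> carrier (hyp_Isom e)" "x \<in> hyp_space e"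
  shows "g ((inv\<^bsub>hyp_Isom e\<^esub> g) x) = x" and "(inv\<^bsub>hyp_Isom e\<^esub> g) (g x) = x"
proof -
  interpret group "hyp_Isom e" by (rule group_hyp_Isom)
  show "g ((inv\<^bsub>hyp_Isom e\<^esub> g) x) = x" "(inv\<^bsub>hyp_Isom e\<^esub> g) (g x) = x"
    using hyp_Isom_mult[of g e "inv\<^bsub>hyp_Isom e\<^esub> g" x] hyp_Isom_mult[of "inv\<^bsub>hyp_Isom e\<^esub> g" e g x]
      hyp_Isom_one[of x e] assms by simp_all
qed

text \<open>The unit-speed geodesic line through \<open>e 0\<close> in the direction
  \<open>e 1\<close>. Moving the base point along it realizes every nonnegative value of the
  logarithmic cocycle.\<close>

definition hyp_geodesic :: "(nat \<Rightarrow> 'h::{real_inner, complete_space}) \<Rightarrow> real \<Rightarrow> 'h"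
  where "hyp_geodesic e t = cosh t *\<^sub>R e 0 + sinh t *\<^sub>R e 1"

lemma hyp_geodesic_0 [simp]: "hyp_geodesic e 0 = e 0"
  by (simp add: hyp_geodesic_def)

context
  fixes e :: "nat \<Rightarrow> 'h::{real_inner, complete_space}"
  assumes e: "hilbert_basis e"
begin

interpretation Metric_space "hyp_space e" "hyp_dist e"
  by (rule Metric_space_hyp[OF e])

lemma hyp_form_geodesic: "hyp_form e (hyp_geodesic e s) (hyp_geodesic e t) = cosh (s - t)"
proof -
  have "inner (e i) (e j) = (if i = j then 1 else 0)" for i j
    using e by (simp add: hilbert_basis_def)
  then show ?thesis
    by (simp add: hyp_form_eq[OF e] hyp_geodesic_def inner_add_left inner_add_right cosh_diff algebra_simps)
qed

lemma hyp_geodesic_in_space: "hyp_geodesic e t \<in> hyp_space e"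
proof -
  have "hyp_Q e (hyp_geodesic e t) = 1"
    using hyp_form_geodesic[of t t] by (simp add: hyp_form_self[OF e])
  moreover have "inner (hyp_geodesic e t) (e 0) = cosh t"
    using e by (simp add: hilbert_basis_def hyp_geodesic_def inner_add_left)
  ultimately show ?thesis by (simp add: hyp_space_def)
qed

lemma basepoint_in_hyp_space: "e 0 \<in> hyp_space e"
  using hyp_geodesic_in_space[of 0] by simp

lemma hyp_dist_geodesic: "hyp_dist e (hyp_geodesic e s) (hyp_geodesic e t) = \<bar>s - t\<bar>"
proof -
  have "arcosh (cosh (s - t)) = arcosh (cosh \<bar>s - t\<bar>)" by simp
  also have "\<dots> = \<bar>s - t\<bar>" by (rule arcosh_cosh_real) simp
  finally show ?thesis
    by (simp add: hyp_dist_def hyp_geodesic_in_space hyp_form_geodesic)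
qed

text \<open>The inverse appears since isometries act on functions through their inverses. The
  witness is the inverse of the point reflection in the midpoint of \<open>e 0\<close> and
  \<open>hyp_geodesic e t\<close>, which exchanges these two points.\<close>

lemma exists_isometry_to_geodesic:
  "\<exists>g\<in>carrier (hyp_Isom e). (inv\<^bsub>hyp_Isom e\<^esub> g) (e 0) = hyp_geodesic e t"
proof -
  interpret group "hyp_Isom e" by (rule group_hyp_Isom)
  let ?m = "hyp_geodesic e (t / 2)"
  define s where "s = (\<lambda>x\<in>hyp_space e. (2 * hyp_form e x ?m) *\<^sub>R ?m - x)"
  have s: "s \<in> carrier (hyp_Isom e)"
    using point_reflection_isometry[OF e hyp_geodesic_in_space] by (simp add: s_def hyp_Isom_def)
  have "s (e 0) = (2 * cosh (t / 2)) *\<^sub>R ?m - e 0"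
    using hyp_form_geodesic[of 0 "t / 2"] basepoint_in_hyp_space by (simp add: s_def)
  also have "\<dots> = (2 * (cosh (t / 2))\<^sup>2 - 1) *\<^sub>R e 0 + (2 * sinh (t / 2) * cosh (t / 2)) *\<^sub>R e 1"
    by (simp add: hyp_geodesic_def algebra_simps power2_eq_square)
  also have "\<dots> = hyp_geodesic e t"
    using cosh_double_cosh[of "t / 2"] sinh_double[of "t / 2"] by (simp add: hyp_geodesic_def)
  finally show ?thesis
    using s by (intro bexI[of _ "inv\<^bsub>hyp_Isom e\<^esub> s"]) simp_all
qed

section \<open>Logarithms of linear functions\<close>

text \<open>
  Examples are \<open>x \<mapsto> ln ((x, v) / (e 0, v))\<close> for \<open>v\<close> in the closed solid light cone, so that
  \<open>log_linear\<close> contains the closed ball bordering the hyperbolic space, in its weak topology. The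
  last condition says that \<open>exp \<circ> b\<close> respects the relation \<open>x + y = 2 cosh r m\<close> for midpoints \<open>m\<close>.
  It is expressed through distances, hence it is invariant under isometries without knowing that
  these are linear.
\<close>

definition log_linear :: "('h \<Rightarrow> real) set"
  where "log_linear = {b \<in> extensional (hyp_space e). b (e 0) = 0 \<and>
    (\<forall>x\<in>hyp_space e. \<forall>y\<in>hyp_space e. b x - b y \<le> hyp_dist e x y) \<and>
    (\<forall>x\<in>hyp_space e. \<forall>y\<in>hyp_space e. \<forall>m\<in>hyp_space e. \<forall>r.
      hyp_dist e x m = r \<and> hyp_dist e y m = r \<and> hyp_dist e x y = 2 * r
      \<longrightarrow> exp (b x) + exp (b y) = 2 * cosh r * exp (b m))}"

lemma
  assumes "b \<in> log_linear"
  shows log_linear_extensional: "b \<in> extensional (hyp_space e)"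
    and log_linear_basepoint: "b (e 0) = 0"
    and log_linear_lipschitz: "x \<in> hyp_space e \<Longrightarrow> y \<in> hyp_space e \<Longrightarrow> \<bar>b x - b y\<bar> \<le> hyp_dist e x y"
    and log_linear_midpoint: "x \<in> hyp_space e \<Longrightarrow> y \<in> hyp_space e \<Longrightarrow> m \<in> hyp_space e \<Longrightarrow>
      hyp_dist e x m = r \<Longrightarrow> hyp_dist e y m = r \<Longrightarrow> hyp_dist e x y = 2 * r
      \<Longrightarrow> exp (b x) + exp (b y) = 2 * cosh r * exp (b m)"
proof -
  show "b \<in> extensional (hyp_space e)" "b (e 0) = 0" using assms by (simp_all add: log_linear_def)
  show "\<bar>b x - b y\<bar> \<le> hyp_dist e x y" if "x \<in> hyp_space e" "y \<in> hyp_space e"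
  proof -
    have "b x - b y \<le> hyp_dist e x y" "b y - b x \<le> hyp_dist e y x"
      using assms that by (auto simp: log_linear_def)
    then show ?thesis using commute[of x y] by linarith
  qed
  show "x \<in> hyp_space e \<Longrightarrow> y \<in> hyp_space e \<Longrightarrow> m \<in> hyp_space e \<Longrightarrow>
      hyp_dist e x m = r \<Longrightarrow> hyp_dist e y m = r \<Longrightarrow> hyp_dist e x y = 2 * r
      \<Longrightarrow> exp (b x) + exp (b y) = 2 * cosh r * exp (b m)"
    using assms unfolding log_linear_def by blast
qed

text \<open>The witness is the centre of the ball, with \<open>v = e 0\<close>: the logarithm of
  cosh of the distance to the base point.\<close>

lemma log_linear_nonempty: "log_linear \<noteq> {}"
proof -
  let ?H = "hyp_space e"
  define b where "b = (\<lambda>x\<in>?H. ln (hyp_form e x (e 0)))"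
  have o: "e 0 \<in> ?H" by (rule basepoint_in_hyp_space)
  have pos: "hyp_form e x (e 0) > 0" if "x \<in> ?H" for x
    using hyp_form_ge_1(1)[OF e that o] by simp
  have exp_b: "exp (b x) = hyp_form e x (e 0)" if "x \<in> ?H" for x
    using pos[OF that] that by (simp add: b_def)
  have "b x - b y \<le> hyp_dist e x y" if x: "x \<in> ?H" and y: "y \<in> ?H" for x y
  proof -
    \<comment> \<open>The Lipschitz bound is the logarithm of cosh (r + q) \<le> exp r * cosh q,
      which holds because exp (- r) \<le> exp r.\<close>
    let ?r = "hyp_dist e x y" and ?q = "hyp_dist e y (e 0)"
    have "hyp_form e x (e 0) = cosh (hyp_dist e x (e 0))"
      by (rule cosh_hyp_dist[OF e x o, symmetric])
    also have "\<dots> \<le> cosh (?r + ?q)"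
      using triangle[OF x y o] by (simp add: cosh_real_nonneg_le_iff)
    also have "\<dots> = (exp ?r * exp ?q + exp (- ?r) * exp (- ?q)) / 2"
      by (simp add: cosh_def flip: exp_add)
    also have "\<dots> \<le> (exp ?r * exp ?q + exp ?r * exp (- ?q)) / 2"
      by (simp add: mult_right_mono)
    also have "\<dots> = exp ?r * cosh ?q"
      by (simp add: cosh_def algebra_simps)
    also have "\<dots> = exp ?r * exp (b y)"
      by (simp add: exp_b[OF y] cosh_hyp_dist[OF e y o])
    finally have "exp (b x) \<le> exp (?r + b y)"
      by (simp add: exp_b[OF x] exp_add)
    then show ?thesis by simp
  qed
  moreover have "exp (b x) + exp (b y) = 2 * cosh r * exp (b m)"
    if x: "x \<in> ?H" and y: "y \<in> ?H" and m: "m \<in> ?H"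
      and r: "hyp_dist e x m = r" "hyp_dist e y m = r" "hyp_dist e x y = 2 * r" for x y m r
  proof -
    have "hyp_form e x m = cosh r" "hyp_form e y m = cosh r"
      using cosh_hyp_dist[OF e x m] cosh_hyp_dist[OF e y m] r by simp_all
    moreover have "hyp_form e x y = 2 * (cosh r)\<^sup>2 - 1"
      using cosh_hyp_dist[OF e x y] r cosh_double_cosh[of r] by simp
    ultimately have "x + y = (2 * cosh r) *\<^sub>R m"
      by (rule hyp_midpoint[OF e x y m])
    \<comment> \<open>Pairing the vector identity for the midpoint with \<open>e 0\<close> turns it
      into the relation between the exponentials.\<close>
    then have "hyp_form e (x + y) (e 0) = hyp_form e ((2 * cosh r) *\<^sub>R m) (e 0)" by simp
    then show ?thesis
      unfolding exp_b[OF x] exp_b[OF y] exp_b[OF m]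
      by (simp add: hyp_form_eq[OF e] inner_add_left algebra_simps)
  qed
  moreover have "b (e 0) = 0"
    using o hyp_form_ge_1(2)[OF e o o] by (simp add: b_def)
  ultimately have "b \<in> log_linear"
    unfolding log_linear_def by (simp add: b_def)
  then show ?thesis by blast
qed

text \<open>The points at parameters \<open>T\<close> and \<open>- T\<close> have midpoint
  \<open>e 0\<close>, where \<open>b\<close> vanishes, so the exponentials of \<open>b\<close> at
  them add up to \<open>2 * cosh T\<close>. One of the two values is therefore at least ln (cosh T),
  and the intermediate value theorem applies between it and 0.\<close>

lemma log_linear_geodesic_surj:
  assumes b: "b \<in> log_linear" and "\<tau> \<ge> 0"
  shows "\<exists>t. b (hyp_geodesic e t) = \<tau>"
proof -
  define h where "h = (\<lambda>t. b (hyp_geodesic e t))"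
  \<comment> \<open>Chosen so that \<open>cosh T = exp \<tau>\<close>; this is where \<tau> \<ge> 0
    enters.\<close>
  define T where "T = arcosh (exp \<tau>)"
  have T: "T \<ge> 0" "cosh T = exp \<tau>"
    using \<open>\<tau> \<ge> 0\<close> by (simp_all add: T_def)
  have cont: "continuous_on UNIV h"
  proof (rule lipschitz_on_continuous_on)
    show "1-lipschitz_on UNIV h"
      using log_linear_lipschitz[OF b hyp_geodesic_in_space hyp_geodesic_in_space]
      by (intro lipschitz_onI) (auto simp: h_def dist_real_def hyp_dist_geodesic)
  qed
  have "exp (h T) + exp (h (- T)) = 2 * cosh T * exp (h 0)"
    unfolding h_def using T(1)
    by (intro log_linear_midpoint[OF b] hyp_geodesic_in_space) (simp_all only: hyp_dist_geodesic)
  also have "\<dots> = 2 * exp \<tau>"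
    using log_linear_basepoint[OF b] T by (simp add: h_def)
  finally have "\<not> (h T < \<tau> \<and> h (- T) < \<tau>)"
    by (smt (verit) exp_less_mono)
  then consider "\<tau> \<le> h T" | "\<tau> \<le> h (- T)" by linarith
  moreover have h0: "h 0 \<le> \<tau>" using log_linear_basepoint[OF b] \<open>\<tau> \<ge> 0\<close> by (simp add: h_def)
  ultimately have "\<exists>t. h t = \<tau>"
  proof cases
    case 1
    then show ?thesis
      using IVT'[of h 0 \<tau> T] h0 T(1) continuous_on_subset[OF cont] by blast
  next
    case 2
    then show ?thesis
      using IVT2'[of h 0 \<tau> "- T"] h0 T(1) continuous_on_subset[OF cont]
      by (metis neg_le_0_iff_le top_greatest)
  qed
  then show ?thesis by (simp add: h_def)
qed


section \<open>A flow with a circle cocycle for every real frequency\<close>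

abbreviation log_linear_topology :: "('h \<Rightarrow> real) topology"
  where "log_linear_topology \<equiv>
    subtopology (product_topology (\<lambda>_. euclideanreal) (hyp_space e)) log_linear"

abbreviation circles_topology :: "(real \<Rightarrow> complex) topology"
  where "circles_topology \<equiv> product_topology (\<lambda>_. top_of_set (sphere 0 1)) UNIV"

lemma topspace_log_linear [simp]: "topspace log_linear_topology = log_linear"
  using log_linear_extensional by (auto simp: PiE_def)

text \<open>Each defining condition involves at most three evaluations, which are continuous on the
  product, so it cuts out a closed set.\<close>

lemma closedin_log_linear: "closedin (product_topology (\<lambda>_. euclideanreal) (hyp_space e)) log_linear"
proof -
  let ?H = "hyp_space e"
  let ?P = "product_topology (\<lambda>_. euclideanreal) ?H"
  have ev: "continuous_map ?P euclideanreal (\<lambda>b. b x)" if "x \<in> ?H" for x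
    using that by (rule continuous_map_product_projection)
  have top: "topspace ?P = extensional ?H" by (simp add: PiE_def)
  define lip where "lip = (\<lambda>x y. {b \<in> topspace ?P. b x - b y \<in> {..hyp_dist e x y}})"
  define mid where "mid = (\<lambda>x y m r. {b \<in> topspace ?P.
    exp (b x) + exp (b y) - 2 * cosh r * exp (b m) \<in> {0}})"
  define C where "C = (\<lambda>x y m r. x \<in> ?H \<and> y \<in> ?H \<and> m \<in> ?H \<and>
    hyp_dist e x m = r \<and> hyp_dist e y m = r \<and> hyp_dist e x y = 2 * r)"
  \<comment> \<open>The base point condition keeps the family nonempty, so that its intersection is
    closed.\<close>
  define K where "K = insert {b \<in> topspace ?P. b (e 0) \<in> {0}}
    ({lip x y | x y. x \<in> ?H \<and> y \<in> ?H} \<union> {mid x y m r | x y m r. C x y m r})"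
  have "closedin ?P {b \<in> topspace ?P. b (e 0) \<in> {0}}"
    by (rule closedin_continuous_map_preimage[OF ev[OF basepoint_in_hyp_space]]) simp
  moreover have "closedin ?P (lip x y)" if "x \<in> ?H" "y \<in> ?H" for x y
    unfolding lip_def using that
    by (intro closedin_continuous_map_preimage[OF continuous_map_diff] ev) auto
  moreover have "closedin ?P (mid x y m r)" if "C x y m r" for x y m r
  proof -
    have exp_ev: "continuous_map ?P euclideanreal (\<lambda>b. exp (b x))" if "x \<in> ?H" for x
      using continuous_map_compose[OF ev[OF that], of euclideanreal exp]
      by (simp add: o_def continuous_on_exp continuous_on_id)
    have "continuous_map ?P euclideanreal (\<lambda>b. exp (b x) + exp (b y) - 2 * cosh r * exp (b m))"
      using that unfolding C_def
      by (intro continuous_map_diff continuous_map_add continuous_map_real_mult_left exp_ev) auto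
    then show ?thesis
      unfolding mid_def by (rule closedin_continuous_map_preimage) simp
  qed
  ultimately have "closedin ?P V" if "V \<in> K" for V
    using that unfolding K_def by (elim insertE UnE CollectE exE conjE) simp_all
  then have closed: "closedin ?P (\<Inter>K)"
    by (intro closedin_Inter) (auto simp: K_def)
  have "log_linear = \<Inter>K"
  proof (rule equalityI; rule subsetI)
    fix b assume b: "b \<in> log_linear"
    then have "b \<in> topspace ?P" unfolding top by (rule log_linear_extensional)
    then have "b \<in> V" if "V \<in> K" for V
      using that log_linear_basepoint[OF b] log_linear_midpoint[OF b] abs_le_D1[OF log_linear_lipschitz[OF b]]
      unfolding K_def by (elim insertE UnE CollectE exE conjE) (simp_all add: lip_def mid_def C_def)
    then show "b \<in> \<Inter>K" by (rule InterI)
  next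
    fix b assume "b \<in> \<Inter>K"
    then have V: "b \<in> V" if "V \<in> K" for V using that by (rule InterD)
    have "b \<in> {b \<in> topspace ?P. b (e 0) \<in> {0}}" by (rule V) (simp add: K_def)
    moreover have "b \<in> lip x y" if "x \<in> ?H" "y \<in> ?H" for x y
      by (rule V) (use that in \<open>unfold K_def, blast\<close>)
    moreover have "b \<in> mid x y m r" if "C x y m r" for x y m r
      by (rule V) (use that in \<open>unfold K_def, blast\<close>)
    ultimately show "b \<in> log_linear"
      unfolding top lip_def mid_def C_def log_linear_def by simp
  qed
  with closed show ?thesis by (simp only:)
qed

text \<open>The value 0 at \<open>e 0\<close> and the Lipschitz bound confine \<open>b x\<close> to
  an interval of radius \<open>hyp_dist e x (e 0)\<close>, so \<open>log_linear\<close> is closed in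
  a compact product of intervals.\<close>

lemma compact_space_log_linear: "compact_space log_linear_topology"
proof -
  let ?I = "\<lambda>x. {- hyp_dist e x (e 0)..hyp_dist e x (e 0)}"
  have "compactin (product_topology (\<lambda>_. euclideanreal) (hyp_space e)) (\<Pi>\<^sub>E x\<in>hyp_space e. ?I x)"
    by (simp add: compactin_PiE)
  moreover have "b x \<in> ?I x" if b: "b \<in> log_linear" and x: "x \<in> hyp_space e" for b x
    using log_linear_lipschitz[OF b x basepoint_in_hyp_space] log_linear_basepoint[OF b] by auto
  then have "log_linear \<subseteq> (\<Pi>\<^sub>E x\<in>hyp_space e. ?I x)"
    by (intro subsetI) (simp only: PiE_iff log_linear_extensional, blast)
  ultimately have "compactin (product_topology (\<lambda>_. euclideanreal) (hyp_space e)) log_linear"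
    using closed_compactin closedin_log_linear by blast
  then show ?thesis by (simp add: compact_space_subtopology)
qed

text \<open>If \<open>b\<close> comes from the cone point \<open>v\<close>, the result comes from
  \<open>g v\<close>. The subtracted constant restores the value 0 at \<open>e 0\<close>; it is the
  logarithm of the cocycle.\<close>

definition renormalize :: "('h \<Rightarrow> 'h) \<Rightarrow> ('h \<Rightarrow> real) \<Rightarrow> 'h \<Rightarrow> real"
  where "renormalize g b = (\<lambda>x\<in>hyp_space e.
    b ((inv\<^bsub>hyp_Isom e\<^esub> g) x) - b ((inv\<^bsub>hyp_Isom e\<^esub> g) (e 0)))"

text \<open>Isometries preserve the distance conditions, and subtracting a constant divides both
  sides of the midpoint relation by the same positive factor.\<close>

lemma renormalize_log_linear:
  assumes g: "g \<in> carrier (hyp_Isom e)" and b: "b \<in> log_linear"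
  shows "renormalize g b \<in> log_linear"
proof -
  let ?H = "hyp_space e"
  define i where "i = inv\<^bsub>hyp_Isom e\<^esub> g"
  define a where "a = b (i (e 0))"
  have i: "i \<in> carrier (hyp_Isom e)" unfolding i_def by (rule hyp_Isom_inv_closed[OF g])
  have ix: "i x \<in> ?H" if "x \<in> ?H" for x by (rule hyp_Isom_closed[OF i that])
  have R: "renormalize g b x = b (i x) - a" if "x \<in> ?H" for x
    using that by (simp add: renormalize_def i_def a_def)
  have "renormalize g b x - renormalize g b y \<le> hyp_dist e x y" if "x \<in> ?H" "y \<in> ?H" for x y
    using log_linear_lipschitz[OF b ix[OF that(1)] ix[OF that(2)]] that
    by (simp add: R hyp_Isom_dist[OF i])
  moreover have "exp (renormalize g b x) + exp (renormalize g b y) = 2 * cosh r * exp (renormalize g b m)"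
    if x: "x \<in> ?H" and y: "y \<in> ?H" and m: "m \<in> ?H"
      and r: "hyp_dist e x m = r" "hyp_dist e y m = r" "hyp_dist e x y = 2 * r" for x y m r
  proof -
    have "exp (b (i x)) + exp (b (i y)) = 2 * cosh r * exp (b (i m))"
      by (rule log_linear_midpoint[OF b ix[OF x] ix[OF y] ix[OF m]])
        (simp_all add: hyp_Isom_dist[OF i] x y m r)
    then show ?thesis
      by (simp add: R x y m exp_diff flip: add_divide_distrib)
  qed
  moreover have "renormalize g b (e 0) = 0" "renormalize g b \<in> extensional ?H"
    by (simp_all add: renormalize_def basepoint_in_hyp_space)
  ultimately show ?thesis unfolding log_linear_def by simp
qed

text \<open>
  Since \<open>b\<close> is 1-Lipschitz, moving \<open>g\<inverse> x\<close> to the fixed point \<open>g0\<inverse> x\<close> changes \<open>b\<close> by at most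
  \<open>d(g\<inverse> x, g0\<inverse> x) = d(x, g (g0\<inverse> x))\<close>, which no longer involves the inverse of \<open>g\<close>.
\<close>

lemma continuous_map_eval_inverse:
  assumes x: "x \<in> hyp_space e"
  shows "continuous_map (prod_topology (hyp_Isom_topology e) log_linear_topology) euclideanreal
    (\<lambda>z. snd z ((inv\<^bsub>hyp_Isom e\<^esub> fst z) x))"
proof -
  let ?H = "hyp_space e" and ?T = "hyp_Isom_topology e"
  let ?X = "prod_topology ?T log_linear_topology"
  let ?F = "\<lambda>z. snd z ((inv\<^bsub>hyp_Isom e\<^esub> fst z) x)"
  have top: "topspace ?X = carrier (hyp_Isom e) \<times> log_linear"
    by (simp only: topspace_prod_topology topspace_log_linear topspace_hyp_Isom_topology[OF e])
  have "limitin euclideanreal ?F (?F z0) (atin ?X z0)" if z0: "z0 \<in> topspace ?X" for z0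
  proof -
    obtain g0 b0 where z0_eq: "z0 = (g0, b0)" and g0: "g0 \<in> carrier (hyp_Isom e)" and b0: "b0 \<in> log_linear"
      using z0 unfolding top by (cases z0) simp
    define y where "y = (inv\<^bsub>hyp_Isom e\<^esub> g0) x"
    have y: "y \<in> ?H" unfolding y_def by (rule hyp_Isom_closed[OF hyp_Isom_inv_closed[OF g0] x])
    have gy: "g0 y = x" unfolding y_def by (rule hyp_Isom_inv[OF g0 x])
    have "continuous_map ?T mtopology (\<lambda>g. g y)"
      unfolding hyp_Isom_topology_def
      by (intro continuous_map_from_subtopology continuous_map_product_projection y)
    then have "continuous_map ?X mtopology ((\<lambda>g. g y) \<circ> fst)"
      by (intro continuous_map_compose[OF continuous_map_fst])
    then have "continuous_map ?X (mtopology_of (metric (?H, hyp_dist e))) (\<lambda>z. fst z y)"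
      by (simp only: mtopology_of o_def)
    moreover have "continuous_map ?X (mtopology_of (metric (?H, hyp_dist e))) (\<lambda>_. x)"
      using x by simp
    ultimately have "continuous_map ?X euclideanreal
        (\<lambda>z. mdist (metric (?H, hyp_dist e)) (fst z y) x)"
      by (rule continuous_map_mdist)
    then have "continuous_map ?X euclideanreal (\<lambda>z. hyp_dist e (fst z y) x)"
      by (simp only: mdist_metric)
    then have "((\<lambda>z. hyp_dist e (fst z y) x) \<longlongrightarrow> hyp_dist e (fst z0 y) x) (atin ?X z0)"
      using z0 unfolding continuous_map_atin limitin_canonical_iff by blast
    then have lim1: "((\<lambda>z. hyp_dist e (fst z y) x) \<longlongrightarrow> 0) (atin ?X z0)"
      unfolding z0_eq fst_conv gy mdist_zero[OF x] .
    have "continuous_map log_linear_topology euclideanreal (\<lambda>b. b y)"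
      by (intro continuous_map_from_subtopology continuous_map_product_projection y)
    then have "continuous_map ?X euclideanreal ((\<lambda>b. b y) \<circ> snd)"
      by (intro continuous_map_compose[OF continuous_map_snd])
    then have lim2: "((\<lambda>z. snd z y) \<longlongrightarrow> snd z0 y) (atin ?X z0)"
      using z0 unfolding continuous_map_atin limitin_canonical_iff o_def by blast
    have bound: "norm (?F z - snd z y) \<le> hyp_dist e (fst z y) x" if z: "z \<in> topspace ?X" for z
    proof -
      obtain g b where zgb: "z = (g, b)" and g: "g \<in> carrier (hyp_Isom e)" and b: "b \<in> log_linear"
        using z unfolding top by (cases z) simp
      let ?i = "inv\<^bsub>hyp_Isom e\<^esub> g"
      have ix: "?i x \<in> ?H" by (rule hyp_Isom_closed[OF hyp_Isom_inv_closed[OF g] x])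
      have "\<bar>b (?i x) - b y\<bar> \<le> hyp_dist e (?i x) y"
        by (rule log_linear_lipschitz[OF b ix y])
      also have "\<dots> = hyp_dist e (g (?i x)) (g y)"
        by (rule hyp_Isom_dist[OF g ix y, symmetric])
      also have "\<dots> = hyp_dist e (g y) x"
        unfolding hyp_Isom_inv(1)[OF g x] by (rule commute)
      finally show ?thesis by (simp add: zgb)
    qed
    have "\<forall>\<^sub>F z in atin ?X z0. norm (?F z - snd z y) \<le> hyp_dist e (fst z y) x"
      unfolding eventually_atin
      by (intro disjI2 exI[of _ "topspace ?X"] conjI ballI bound openin_topspace z0) (rule DiffD1)
    then have "((\<lambda>z. ?F z - snd z y) \<longlongrightarrow> 0) (atin ?X z0)"
      by (rule Lim_null_comparison[OF _ lim1])
    from tendsto_add[OF this lim2] show ?thesis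
      by (simp add: z0_eq y_def)
  qed
  then show ?thesis unfolding continuous_map_atin by blast
qed

text \<open>A skew product over the ball: the circle of frequency \<open>s\<close> turns by
  \<open>s\<close> times the logarithm of the cocycle.\<close>

definition cocycle_action :: "('h \<Rightarrow> 'h) \<Rightarrow> ('h \<Rightarrow> real) \<times> (real \<Rightarrow> complex) \<Rightarrow> ('h \<Rightarrow> real) \<times> (real \<Rightarrow> complex)"
  where "cocycle_action g = (\<lambda>(b, k).
    (renormalize g b, \<lambda>s. k s * cis (s * b ((inv\<^bsub>hyp_Isom e\<^esub> g) (e 0)))))"

text \<open>Compatibility with products is the cocycle identity: the angle of a product
  \<open>g h\<close> at \<open>b\<close> is that of \<open>h\<close> at \<open>b\<close> plus that
  of \<open>g\<close> at \<open>renormalize h b\<close>.\<close>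

lemma flow_cocycle_action:
  "flow (hyp_Isom e) (hyp_Isom_topology e) (prod_topology log_linear_topology circles_topology)
    (\<lambda>g. restrict (cocycle_action g) (topspace (prod_topology log_linear_topology circles_topology)))"
proof (rule flowI[OF group_hyp_Isom topspace_hyp_Isom_topology[OF e]])
  let ?X = "prod_topology log_linear_topology circles_topology"
  let ?T = "hyp_Isom_topology e" and ?H = "hyp_space e"
  interpret group "hyp_Isom e" by (rule group_hyp_Isom)
  have topC: "topspace circles_topology = {k. \<forall>s. norm (k s) = 1}"
    by (auto simp: PiE_def Pi_def)
  have top: "topspace ?X = log_linear \<times> {k. \<forall>s. norm (k s) = 1}"
    by (simp only: topspace_prod_topology topspace_log_linear topC)
  show "compact_space ?X"
    unfolding compact_space_prod_topology
    by (intro disjI2 conjI compact_space_log_linear) (simp add: compact_space_product_topology compact_space_subtopology)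
  show "Hausdorff_space ?X"
    unfolding Hausdorff_space_prod_topology
    by (intro disjI2 conjI Hausdorff_space_subtopology)
      (auto simp: Hausdorff_space_product_topology intro!: Hausdorff_space_subtopology)
  show "topspace ?X \<noteq> {}"
    unfolding top using log_linear_nonempty by (auto intro!: exI[of _ "\<lambda>_. 1"])
  show "cocycle_action \<one>\<^bsub>hyp_Isom e\<^esub> z = z" if "z \<in> topspace ?X" for z
  proof -
    obtain b k where z: "z = (b, k)" and b: "b \<in> log_linear" using \<open>z \<in> topspace ?X\<close> unfolding top by blast
    have "renormalize \<one>\<^bsub>hyp_Isom e\<^esub> b = b"
      using b by (intro ext) (auto simp: renormalize_def hyp_Isom_one basepoint_in_hyp_space log_linear_def extensional_def)
    then show ?thesis
      by (simp add: z cocycle_action_def hyp_Isom_one basepoint_in_hyp_space log_linear_basepoint[OF b])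
  qed
  show "cocycle_action (g \<otimes>\<^bsub>hyp_Isom e\<^esub> h) z = cocycle_action g (cocycle_action h z)"
    if g: "g \<in> carrier (hyp_Isom e)" and h: "h \<in> carrier (hyp_Isom e)" for g h z
  proof -
    obtain b k where z: "z = (b, k)" by fastforce
    have inv: "(inv\<^bsub>hyp_Isom e\<^esub> (g \<otimes>\<^bsub>hyp_Isom e\<^esub> h)) x = (inv\<^bsub>hyp_Isom e\<^esub> h) ((inv\<^bsub>hyp_Isom e\<^esub> g) x)"
      if "x \<in> ?H" for x
      using that g h by (simp add: inv_mult_group hyp_Isom_mult)
    have ig: "(inv\<^bsub>hyp_Isom e\<^esub> g) x \<in> ?H" if "x \<in> ?H" for x
      by (rule hyp_Isom_closed[OF hyp_Isom_inv_closed[OF g] that])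
    have "renormalize (g \<otimes>\<^bsub>hyp_Isom e\<^esub> h) b = renormalize g (renormalize h b)"
      by (intro ext) (simp add: renormalize_def inv ig basepoint_in_hyp_space)
    then show ?thesis
      by (simp add: z cocycle_action_def inv ig basepoint_in_hyp_space renormalize_def
          cis_mult algebra_simps)
  qed
  let ?Y = "prod_topology ?T ?X"
  have "continuous_map ?Y (prod_topology ?T log_linear_topology) (\<lambda>z. (fst z, fst (snd z)))"
    unfolding continuous_map_paired
    using continuous_map_compose[OF continuous_map_snd[of ?T ?X] continuous_map_fst] continuous_map_fst
    by (simp add: o_def)
  \<comment> \<open>Both coordinates of the action are built from evaluations of \<open>b\<close> at
    inverse images of points, so joint continuity reduces to that of these evaluations.\<close>
  note compose = continuous_map_compose[OF this continuous_map_eval_inverse]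
  have ev: "continuous_map ?Y euclideanreal (\<lambda>z. fst (snd z) ((inv\<^bsub>hyp_Isom e\<^esub> fst z) x))"
    if "x \<in> ?H" for x
    using compose[OF that] by (simp add: o_def)
  have topY: "topspace ?Y = carrier (hyp_Isom e) \<times> log_linear \<times> {k. \<forall>s. norm (k s) = 1}"
    by (simp only: topspace_prod_topology[of ?T] top topspace_hyp_Isom_topology[OF e])
  have 1: "continuous_map ?Y log_linear_topology (\<lambda>z. renormalize (fst z) (fst (snd z)))"
  proof (rule continuous_map_into_subtopology)
    show "continuous_map ?Y (product_topology (\<lambda>_. euclideanreal) ?H)
        (\<lambda>z. renormalize (fst z) (fst (snd z)))"
      unfolding continuous_map_componentwise
    proof (intro conjI ballI)
      show "(\<lambda>z. renormalize (fst z) (fst (snd z))) ` topspace ?Y \<subseteq> extensional ?H"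
        by (auto simp: renormalize_def)
      show "continuous_map ?Y euclideanreal (\<lambda>z. renormalize (fst z) (fst (snd z)) x)" if x: "x \<in> ?H" for x
        using continuous_map_diff[OF ev[OF x] ev[OF basepoint_in_hyp_space]] x
        by (simp add: renormalize_def)
    qed
    show "(\<lambda>z. renormalize (fst z) (fst (snd z))) \<in> topspace ?Y \<rightarrow> log_linear"
      unfolding topY using renormalize_log_linear by auto
  qed
  have 2: "continuous_map ?Y circles_topology
      (\<lambda>z s. snd (snd z) s * cis (s * fst (snd z) ((inv\<^bsub>hyp_Isom e\<^esub> fst z) (e 0))))"
    unfolding continuous_map_componentwise_UNIV
  proof (rule allI, rule continuous_map_into_subtopology)
    fix s :: real
    have "continuous_map circles_topology (top_of_set (sphere 0 1)) (\<lambda>k. k s)"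
      by (rule continuous_map_product_projection) simp
    then have "continuous_map circles_topology euclidean (\<lambda>k. k s)"
      by (rule continuous_map_into_fulltopology)
    then have k: "continuous_map ?Y euclidean (\<lambda>z. snd (snd z) s)"
      using continuous_map_compose[OF continuous_map_compose[OF continuous_map_snd[of ?T ?X] continuous_map_snd]]
      by (fastforce simp: o_def)
    have "continuous_map ?Y euclidean ((\<lambda>t. cis (s * t)) \<circ> (\<lambda>z. fst (snd z) ((inv\<^bsub>hyp_Isom e\<^esub> fst z) (e 0))))"
      by (rule continuous_map_compose[OF ev[OF basepoint_in_hyp_space]])
        (simp add: continuous_on_cis continuous_intros)
    then show "continuous_map ?Y euclidean
        (\<lambda>z. snd (snd z) s * cis (s * fst (snd z) ((inv\<^bsub>hyp_Isom e\<^esub> fst z) (e 0))))"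
      using k by (simp add: continuous_map_atin tendsto_mult o_def)
    show "(\<lambda>z. snd (snd z) s * cis (s * fst (snd z) ((inv\<^bsub>hyp_Isom e\<^esub> fst z) (e 0))))
        \<in> topspace ?Y \<rightarrow> sphere 0 1"
      unfolding topY by (auto simp: norm_mult)
  qed
  show "continuous_map ?Y ?X (\<lambda>(g, z). cocycle_action g z)"
    using 1 2 unfolding cocycle_action_def case_prod_unfold continuous_map_paired by blast
qed

text \<open>Two group elements are compared, one with logarithmic cocycle 0 and one with \<tau>,
  which shifts the relative phase of the two circles by half a turn. The resulting distances are the
  norms of \<open>k s - k s'\<close> and \<open>k s + k s'\<close>; they add up to at least
  2.\<close>

lemma cocycle_action_separates:
  assumes b: "b \<in> log_linear" and k: "\<And>s. norm (k s) = 1" and "s \<noteq> s'"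
  shows "\<exists>g\<in>carrier (hyp_Isom e).
    dist (snd (cocycle_action g (b, k)) s) (snd (cocycle_action g (b, k)) s') \<ge> 1"
proof -
  have reach: "\<exists>g\<in>carrier (hyp_Isom e). \<forall>s. snd (cocycle_action g (b, k)) s = k s * cis (s * \<tau>)"
    if \<tau>: "\<tau> \<ge> 0" for \<tau>
  proof -
    obtain t where t: "b (hyp_geodesic e t) = \<tau>"
      using log_linear_geodesic_surj[OF b \<tau>] by blast
    obtain g where "g \<in> carrier (hyp_Isom e)" "(inv\<^bsub>hyp_Isom e\<^esub> g) (e 0) = hyp_geodesic e t"
      using exists_isometry_to_geodesic by blast
    then show ?thesis using t by (intro bexI[of _ g]) (simp_all add: cocycle_action_def)
  qed
  \<comment> \<open>The smallest positive value at which the phases for \<open>s\<close> and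
    \<open>s'\<close> become opposite.\<close>
  define \<tau> where "\<tau> = pi / \<bar>s - s'\<bar>"
  define w where "w = cis (s' * \<tau>)"
  have "(s - s') * \<tau> = pi \<or> (s - s') * \<tau> = - pi"
    using \<open>s \<noteq> s'\<close> by (cases "s > s'") (auto simp: \<tau>_def field_simps)
  then have "cis ((s - s') * \<tau>) = -1"
    by (auto simp: complex_eq_iff)
  moreover have "s * \<tau> = (s - s') * \<tau> + s' * \<tau>" by (simp add: algebra_simps)
  ultimately have cis: "cis (s * \<tau>) = - w" by (simp only: w_def cis_mult[symmetric] mult_minus1)
  have "k s * cis (s * \<tau>) - k s' * w = - ((k s + k s') * w)"
    unfolding cis by (simp add: algebra_simps)
  then have "dist (k s * cis (s * \<tau>)) (k s' * w) = norm (k s + k s')"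
    by (simp only: dist_norm norm_minus_cancel norm_mult) (simp add: w_def)
  moreover have "norm (k s + k s') + norm (k s - k s') \<ge> 2"
    using norm_triangle_ineq[of "k s + k s'" "k s - k s'"] k[of s] by (simp add: norm_mult flip: mult_2)
  ultimately consider "norm (k s - k s') \<ge> 1" | "dist (k s * cis (s * \<tau>)) (k s' * cis (s' * \<tau>)) \<ge> 1"
    by (force simp: w_def)
  then show ?thesis
  proof cases
    case 1
    moreover obtain g where "g \<in> carrier (hyp_Isom e)" "\<And>s. snd (cocycle_action g (b, k)) s = k s"
      using reach[of 0] by auto
    ultimately show ?thesis by (intro bexI[of _ g]) (simp_all add: dist_norm)
  next
    case 2
    moreover have "\<tau> \<ge> 0" by (simp add: \<tau>_def)
    then obtain g where "g \<in> carrier (hyp_Isom e)"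
      "\<And>s. snd (cocycle_action g (b, k)) s = k s * cis (s * \<tau>)"
      using reach by blast
    ultimately show ?thesis by (intro bexI[of _ g]) simp_all
  qed
qed

end

section \<open>Non-metrizability of the universal minimal flow\<close>

theorem corollary7p11:
  fixes e :: "nat \<Rightarrow> 'h::{real_inner, complete_space}"
    and M :: "'m topology"
    and \<phi> :: "('h \<Rightarrow> 'h) \<Rightarrow> 'm \<Rightarrow> 'm"
  assumes "hilbert_basis e"
    and "universal_minimal_flow (hyp_Isom e) (hyp_Isom_topology e) M \<phi>"
  shows "\<not> metrizable_space M"
proof
  assume metrizable: "metrizable_space M"
  note e = assms(1)
  let ?G = "hyp_Isom e" and ?T = "hyp_Isom_topology e"
  let ?X = "prod_topology (log_linear_topology e) circles_topology"
  have T: "topspace ?T = carrier ?G" by (rule topspace_hyp_Isom_topology[OF e])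
  have flM: "flow ?G ?T M \<phi>"
    using assms(2) unfolding universal_minimal_flow_def minimal_flow_def by (elim conjE)
  obtain f where "flow_morphism ?G M \<phi> ?X (\<lambda>g. restrict (cocycle_action e g) (topspace ?X)) f"
    using universal_minimal_flow_morphism[OF assms(2) T flow_cocycle_action[OF e]] by (rule exE)
  then have f: "continuous_map M ?X f"
    and eq: "\<And>g x. g \<in> carrier ?G \<Longrightarrow> x \<in> topspace M
      \<Longrightarrow> f (\<phi> g x) = restrict (cocycle_action e g) (topspace ?X) (f x)"
    unfolding flow_morphism_def by simp_all
  have compact: "compact_space M" using flM unfolding flow_def by (rule conjunct1)
  obtain x where x: "x \<in> topspace M" using flow_nonempty[OF flM] by blast
  have fx: "f x \<in> topspace ?X" using continuous_map_funspace[OF f] x by (rule funcset_mem)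
  obtain b k where bk: "f x = (b, k)" by (cases "f x")
  have "b \<in> topspace (log_linear_topology e)" and "k \<in> topspace circles_topology"
    using fx unfolding bk topspace_prod_topology by (rule SigmaD1, rule SigmaD2)
  then have b: "b \<in> log_linear e" and k: "\<And>s. norm (k s) = 1"
    unfolding topspace_log_linear[OF e] by (simp_all add: PiE_iff)
  \<comment> \<open>The circle coordinates of the morphism \<open>f\<close>, one continuous function
    on \<open>M\<close> per real frequency.\<close>
  define F where "F = (\<lambda>(s::real) y. snd (f y) s)"
  have "countable (UNIV :: real set)"
  proof (rule countable_separated_continuous_maps[OF compact _ zero_less_one, of UNIV F])
    show "second_countable M"
      by (rule compact_metrizable_imp_second_countable[OF compact metrizable])
    show "continuous_map M euclidean (F s)" for s
    proof -
      have "continuous_map circles_topology (top_of_set (sphere 0 1)) (\<lambda>k. k s)"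
        by (rule continuous_map_product_projection) simp
      then have "continuous_map circles_topology euclidean (\<lambda>k. k s)"
        by (rule continuous_map_into_fulltopology)
      then have "continuous_map M euclidean ((\<lambda>k. k s) \<circ> (snd \<circ> f))"
        by (intro continuous_map_compose[OF continuous_map_compose[OF f continuous_map_snd]])
      then show ?thesis by (simp add: F_def o_def)
    qed
    fix s s' :: real assume ss: "s \<noteq> s'"
    obtain g where g: "g \<in> carrier ?G"
      and sep: "dist (snd (cocycle_action e g (b, k)) s) (snd (cocycle_action e g (b, k)) s') \<ge> 1"
      using cocycle_action_separates[OF e b, of k s s', OF k ss] by (elim bexE)
    \<comment> \<open>By equivariance, \<open>F\<close> on the orbit of \<open>x\<close> is read off
      from the action on \<open>(b, k)\<close>, where different frequencies are already
      separated.\<close>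
    have "F t (\<phi> g x) = snd (cocycle_action e g (b, k)) t" for t
      unfolding F_def eq[OF g x] bk restrict_apply'[OF fx[unfolded bk]] ..
    then show "\<exists>y\<in>topspace M. dist (F s y) (F s' y) \<ge> 1"
      using sep flow_closed[OF flM g x] by (intro bexI[of _ "\<phi> g x"]) simp_all
  qed
  then show False using uncountable_UNIV_real by blast
qed

end
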